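(* The nucleus functor $\mathrm{Nuc}:\mathsf{Adj}\to\mathsf{Adj}$ is well-defined: - for every adjunction $F=(F^*\dashv F_*:\mathcal B\to\mathcal A)$, $\mathrm{Nuc}(F)=(F^\sharp\dashv F_\sharp:\mathrm{Alg}(F)\to\mathrm{Coalg}(F))$ is an adjunction, with left adjoint $F^\sharp:\mathrm{Coalg}(F)\to\mathrm{Alg}(F)$ and right adjoint $F_\sharp:\mathrm{Alg}(F)\to\mathrm{Coalg}(F)$; and - for every morphism $\Upsilon=(H,K,\upsilon^*,\upsilon_* ):F\to G$ in $\mathsf{Adj}$, $\mathrm{Nuc}(\Upsilon)=(K^\upsilon,H^\upsilon,\upsilon^\sharp,\upsilon_\sharp)$ is a morphism of adjunctions $\mathrm{Nuc}(F)\to\mathrm{Nuc}(G)$.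
   Context: An adjunction $F=(F^*\dashv F_*:\mathcal B\to\mathcal A)$ has left adjoint $F^*:\mathcal A\to\mathcal B$, right adjoint $F_*:\mathcal B\to\mathcal A$, unit $\eta^F:\mathrm{Id}\to F_*F^*$, counit $\varepsilon^F:F^*F_*\to\mathrm{Id}$. The category $\mathsf{Adj}$ has adjunctions as objects. A morphism from $F$ to $G=(G^*\dashv G_*:\mathcal D\to\mathcal C)$ is $(H,K,\upsilon^*,\upsilon_* )$ where $H:\mathcal A\to\mathcal C$ and $K:\mathcal B\to\mathcal D$ are functors and $\upsilon^*:KF^*\cong G^*H$, $\upsilon_*:HF_*\cong G_*K$ are natural isomorphisms such that $$G_*\upsilon^*\circ\upsilon_*F^*\circ H\eta^F=\eta^GH,\qquad \varepsilon^GK\circ G^*\upsilon_*\circ\upsilon^*F_*=K\varepsilon^F.$$ Composition is by pasting. $\mathrm{Alg}(F)$ is the Eilenberg–Moore category of the monad $F_*F^*$ on $\mathcal A$ with forgetful functor $U_F$, and $\mathrm{Coalg}(F)$ is the category of coalgebras for the comonad $F^*F_*$ on $\mathcal B$ with forgetful functor $V^F$. The comparison functors are $\kappa^0:\mathcal A\to\mathrm{Coalg}(F)$, $a\mapsto(F^*\eta_a:F^*a\to F^*F_*F^*a)$, and $\kappa_1:\mathcal B\to\mathrm{Alg}(F)$, $b\mapsto(F_*\varepsilon_b:F_*F^*F_*b\to F_*b)$. Define $F_\sharp=\kappa^0\circ U_F$ and $F^\sharp=\kappa_1\circ V^F$. So $F_\sharp$ sends $\alpha:F_*F^*x\to x$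 to $F^*\eta_x:F^*x\to F^*F_*F^*x$ and acts on arrows as $F^*$, while $F^\sharp$ sends $\beta:y\to F^*F_*y$ to $F_*\varepsilon_y:F_*F^*F_*y\to F_*y$ and acts on arrows as $F_*$. The adjunction equipment of $F^\sharp\dashv F_\sharp$ is given by the correspondence $\mathrm{Alg}(F)(F^\sharp\beta,\alpha)\cong\mathrm{Coalg}(F)(\beta,F_\sharp\alpha)$, $f\mapsto F^*f\circ\beta$. For a morphism $(H,K,\upsilon^*,\upsilon_* ):F\to G$: - $K^\upsilon:\mathrm{Coalg}(F)\to\mathrm{Coalg}(G)$ sends $\beta:b\to F^*F_*b$ to $Kb\xrightarrow{K\beta}KF^*F_*b\xrightarrow{\upsilon^*F_*}G^*HF_*b\xrightarrow{G^*\upsilon_*}G^*G_*Kb$ and acts on arrows as $K$; - $H^\upsilon:\mathrm{Alg}(F)\to\mathrm{Alg}(G)$ sends $\alpha:F_*F^*a\to a$ to $G_*G^*Ha\xrightarrow{(G_*\upsilon^* )^{-1}}G_*KF^*a\xrightarrow{(\upsilon_*F^* )^{-1}}HF_*F^*a\xrightarrow{H\alpha}Ha$ and acts on arrows as $H$; - $\upsilon^\sharp:H^\upsilon F^\sharp\cong G^\sharp K^\upsilon$ has at $\beta:y\to F^*F_*y$ the underlying arrow $\upsilon_{*,y}:HF_*y\to G_*Ky$; - $\upsilon_\sharp:K^\upsilon F_\sharp\cong G_\sharp H^\upsilon$ has at $\alpha:F_*F^*x\to x$ the underlying arrow $\upsilon^*_x:KF^*x\to G^*Hx$. *)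

theory Defs
  imports Main "HOL-Library.FuncSet"
begin

section \<open>Categories, functors, natural transformations\<close>

text \<open>The values of \<open>Dom\<close>, \<open>Cod\<close>, \<open>Ide\<close>, \<open>Comp\<close> outside the carriers (respectively on
  non-composable pairs) carry no meaning.\<close>

record ('o, 'm) cat =
  Obj :: "'o set"
  Arr :: "'m set"
  Dom :: "'m \<Rightarrow> 'o"
  Cod :: "'m \<Rightarrow> 'o"
  Ide :: "'o \<Rightarrow> 'm"
  Comp :: "'m \<Rightarrow> 'm \<Rightarrow> 'm"  (infixr \<open>\<cdot>\<index>\<close> 70)

definition Hom :: "('o, 'm) cat \<Rightarrow> 'o \<Rightarrow> 'o \<Rightarrow> 'm set" where
  "Hom C x y = {f \<in> Arr C. Dom C f = x \<and> Cod C f = y}"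

locale category =
  fixes C :: "('o, 'm) cat" (structure)
  assumes Dom_Obj: "f \<in> Arr C \<Longrightarrow> Dom C f \<in> Obj C"
    and Cod_Obj: "f \<in> Arr C \<Longrightarrow> Cod C f \<in> Obj C"
    and Ide_Hom: "x \<in> Obj C \<Longrightarrow> Ide C x \<in> Hom C x x"
    and Comp_Hom: "f \<in> Hom C x y \<Longrightarrow> g \<in> Hom C y z \<Longrightarrow> g \<cdot> f \<in> Hom C x z"
    and Comp_Ide: "f \<in> Hom C x y \<Longrightarrow> f \<cdot> Ide C x = f"
    and Ide_Comp: "f \<in> Hom C x y \<Longrightarrow> Ide C y \<cdot> f = f"
    and Comp_assoc: "f \<in> Hom C w x \<Longrightarrow> g \<in> Hom C x y \<Longrightarrow> h \<in> Hom C y z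
      \<Longrightarrow> (h \<cdot> g) \<cdot> f = h \<cdot> (g \<cdot> f)"

definition inverse_arrows :: "('o, 'm) cat \<Rightarrow> 'm \<Rightarrow> 'm \<Rightarrow> bool" where
  "inverse_arrows C f g \<longleftrightarrow> f \<in> Arr C \<and> g \<in> Hom C (Cod C f) (Dom C f)
     \<and> g \<cdot>\<^bsub>C\<^esub> f = Ide C (Dom C f) \<and> f \<cdot>\<^bsub>C\<^esub> g = Ide C (Cod C f)"

definition iso_arrow :: "('o, 'm) cat \<Rightarrow> 'm \<Rightarrow> bool" where
  "iso_arrow C f \<longleftrightarrow> (\<exists>g. inverse_arrows C f g)"

definition inv_arrow :: "('o, 'm) cat \<Rightarrow> 'm \<Rightarrow> 'm" where
  "inv_arrow C f = (THE g. inverse_arrows C f g)"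

record ('o, 'm, 'p, 'n) functr =
  FOb :: "'o \<Rightarrow> 'p"
  FAr :: "'m \<Rightarrow> 'n"

text \<open>Functors and natural transformations are extensional functions on the source category,
  so that HOL equality between them is equality of functors and of natural transformations.\<close>

locale cat_functor = src: category A + tgt: category B
  for A :: "('o, 'm) cat" and B :: "('p, 'n) cat" +
  fixes T :: "('o, 'm, 'p, 'n) functr"
  assumes FOb_Obj: "x \<in> Obj A \<Longrightarrow> FOb T x \<in> Obj B"
    and FAr_Hom: "f \<in> Hom A x y \<Longrightarrow> FAr T f \<in> Hom B (FOb T x) (FOb T y)"
    and FAr_Ide: "x \<in> Obj A \<Longrightarrow> FAr T (Ide A x) = Ide B (FOb T x)"
    and FAr_Comp: "f \<in> Hom A x y \<Longrightarrow> g \<in> Hom A y z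
      \<Longrightarrow> FAr T (g \<cdot>\<^bsub>A\<^esub> f) = FAr T g \<cdot>\<^bsub>B\<^esub> FAr T f"
    and FOb_extensional: "FOb T \<in> extensional (Obj A)"
    and FAr_extensional: "FAr T \<in> extensional (Arr A)"

definition id_functor :: "('o, 'm) cat \<Rightarrow> ('o, 'm, 'o, 'm) functr" where
  "id_functor A = \<lparr> FOb = (\<lambda>x\<in>Obj A. x), FAr = (\<lambda>f\<in>Arr A. f) \<rparr>"

text \<open>\<open>comp_functor A S T\<close> is \<open>S \<circ> T\<close>, where \<open>A\<close> is the source of \<open>T\<close>.\<close>

definition comp_functor :: "('o, 'm) cat \<Rightarrow> ('p, 'n, 'q, 'k) functr \<Rightarrow> ('o, 'm, 'p, 'n) functr
    \<Rightarrow> ('o, 'm, 'q, 'k) functr" where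
  "comp_functor A S T = \<lparr> FOb = compose (Obj A) (FOb S) (FOb T),
                          FAr = compose (Arr A) (FAr S) (FAr T) \<rparr>"

locale nat_transformation = S: cat_functor A B S + T: cat_functor A B T
  for A :: "('o, 'm) cat" and B :: "('p, 'n) cat" and S T +
  fixes \<tau> :: "'o \<Rightarrow> 'n"
  assumes component_Hom: "x \<in> Obj A \<Longrightarrow> \<tau> x \<in> Hom B (FOb S x) (FOb T x)"
    and naturality: "f \<in> Hom A x y \<Longrightarrow> FAr T f \<cdot>\<^bsub>B\<^esub> \<tau> x = \<tau> y \<cdot>\<^bsub>B\<^esub> FAr S f"
    and components_extensional: "\<tau> \<in> extensional (Obj A)"

locale nat_isomorphism = nat_transformation +
  assumes component_iso: "x \<in> Obj A \<Longrightarrow> iso_arrow B (\<tau> x)"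


section \<open>Adjunctions and their morphisms\<close>

text \<open>An adjunction \<open>F = (F\<^sup>* \<stileturn> F\<^sub>* : B \<rightarrow> A)\<close>, with \<open>Lad F = F\<^sup>*\<close> and
  \<open>Rad F = F\<^sub>*\<close>.\<close>

record ('oa, 'ma, 'ob, 'mb) adj =
  Acat :: "('oa, 'ma) cat"
  Bcat :: "('ob, 'mb) cat"
  Lad :: "('oa, 'ma, 'ob, 'mb) functr"
  Rad :: "('ob, 'mb, 'oa, 'ma) functr"
  Unit :: "'oa \<Rightarrow> 'ma"
  Counit :: "'ob \<Rightarrow> 'mb"

locale adjunction =
  fixes F :: "('oa, 'ma, 'ob, 'mb) adj"
  assumes Lad_functor: "cat_functor (Acat F) (Bcat F) (Lad F)"
    and Rad_functor: "cat_functor (Bcat F) (Acat F) (Rad F)"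
    and Unit_natural: "nat_transformation (Acat F) (Acat F)
      (id_functor (Acat F)) (comp_functor (Acat F) (Rad F) (Lad F)) (Unit F)"
    and Counit_natural: "nat_transformation (Bcat F) (Bcat F)
      (comp_functor (Bcat F) (Lad F) (Rad F)) (id_functor (Bcat F)) (Counit F)"
    and triangle_Lad: "a \<in> Obj (Acat F) \<Longrightarrow>
      Counit F (FOb (Lad F) a) \<cdot>\<^bsub>Bcat F\<^esub> FAr (Lad F) (Unit F a) = Ide (Bcat F) (FOb (Lad F) a)"
    and triangle_Rad: "b \<in> Obj (Bcat F) \<Longrightarrow>
      FAr (Rad F) (Counit F b) \<cdot>\<^bsub>Acat F\<^esub> Unit F (FOb (Rad F) b) = Ide (Acat F) (FOb (Rad F) b)"

text \<open>A morphism \<open>(H, K, \<upsilon>\<^sup>*, \<upsilon>\<^sub>*)\<close> of adjunctions.\<close>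

record ('oa, 'ma, 'ob, 'mb, 'oc, 'mc, 'od, 'md) adj_mor =
  MH :: "('oa, 'ma, 'oc, 'mc) functr"
  MK :: "('ob, 'mb, 'od, 'md) functr"
  upL :: "'oa \<Rightarrow> 'md"
  upR :: "'ob \<Rightarrow> 'mc"

locale adj_morphism = F: adjunction F + G: adjunction G
  for F :: "('oa, 'ma, 'ob, 'mb) adj" and G :: "('oc, 'mc, 'od, 'md) adj" +
  fixes Y :: "('oa, 'ma, 'ob, 'mb, 'oc, 'mc, 'od, 'md) adj_mor"
  assumes MH_functor: "cat_functor (Acat F) (Acat G) (MH Y)"
    and MK_functor: "cat_functor (Bcat F) (Bcat G) (MK Y)"
    and upL_iso: "nat_isomorphism (Acat F) (Bcat G)
      (comp_functor (Acat F) (MK Y) (Lad F)) (comp_functor (Acat F) (Lad G) (MH Y)) (upL Y)"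
    and upR_iso: "nat_isomorphism (Bcat F) (Acat G)
      (comp_functor (Bcat F) (MH Y) (Rad F)) (comp_functor (Bcat F) (Rad G) (MK Y)) (upR Y)"
    and Unit_compat: "a \<in> Obj (Acat F) \<Longrightarrow>
      FAr (Rad G) (upL Y a) \<cdot>\<^bsub>Acat G\<^esub> upR Y (FOb (Lad F) a) \<cdot>\<^bsub>Acat G\<^esub> FAr (MH Y) (Unit F a)
        = Unit G (FOb (MH Y) a)"
    and Counit_compat: "b \<in> Obj (Bcat F) \<Longrightarrow>
      Counit G (FOb (MK Y) b) \<cdot>\<^bsub>Bcat G\<^esub> FAr (Lad G) (upR Y b) \<cdot>\<^bsub>Bcat G\<^esub> upL Y (FOb (Rad F) b)
        = FAr (MK Y) (Counit F b)"

definition id_adj_mor :: "('oa, 'ma, 'ob, 'mb) adj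
    \<Rightarrow> ('oa, 'ma, 'ob, 'mb, 'oa, 'ma, 'ob, 'mb) adj_mor" where
  "id_adj_mor F = \<lparr>
     MH = id_functor (Acat F),
     MK = id_functor (Bcat F),
     upL = (\<lambda>a\<in>Obj (Acat F). Ide (Bcat F) (FOb (Lad F) a)),
     upR = (\<lambda>b\<in>Obj (Bcat F). Ide (Acat F) (FOb (Rad F) b)) \<rparr>"

text \<open>Pasting of \<open>Y : F \<rightarrow> G\<close> and \<open>Z : G \<rightarrow> L\<close>.\<close>

definition comp_adj_mor :: "('oa, 'ma, 'ob, 'mb) adj \<Rightarrow> ('oe, 'me, 'of, 'mf) adj
    \<Rightarrow> ('oc, 'mc, 'od, 'md, 'oe, 'me, 'of, 'mf) adj_mor
    \<Rightarrow> ('oa, 'ma, 'ob, 'mb, 'oc, 'mc, 'od, 'md) adj_mor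
    \<Rightarrow> ('oa, 'ma, 'ob, 'mb, 'oe, 'me, 'of, 'mf) adj_mor" where
  "comp_adj_mor F L Z Y = \<lparr>
     MH = comp_functor (Acat F) (MH Z) (MH Y),
     MK = comp_functor (Bcat F) (MK Z) (MK Y),
     upL = (\<lambda>a\<in>Obj (Acat F). upL Z (FOb (MH Y) a) \<cdot>\<^bsub>Bcat L\<^esub> FAr (MK Z) (upL Y a)),
     upR = (\<lambda>b\<in>Obj (Bcat F). upR Z (FOb (MK Y) b) \<cdot>\<^bsub>Acat L\<^esub> FAr (MH Z) (upR Y b)) \<rparr>"

text \<open>The category of adjunctions between categories over fixed types of objects and arrows.
  These types are arbitrary and play the role of the universe bounding the size.\<close>

definition Adj :: "(('oa, 'ma, 'ob, 'mb) adj,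
    ('oa, 'ma, 'ob, 'mb) adj \<times> ('oa, 'ma, 'ob, 'mb, 'oa, 'ma, 'ob, 'mb) adj_mor
      \<times> ('oa, 'ma, 'ob, 'mb) adj) cat" where
  "Adj = \<lparr>
     Obj = {F. adjunction F},
     Arr = {(F, Y, G). adj_morphism F G Y},
     Dom = (\<lambda>(F, Y, G). F),
     Cod = (\<lambda>(F, Y, G). G),
     Ide = (\<lambda>F. (F, id_adj_mor F, F)),
     Comp = (\<lambda>(G, Z, L) (F, Y, _). (F, comp_adj_mor F L Z Y, L)) \<rparr>"


section \<open>Algebras and coalgebras\<close>

text \<open>An algebra is a pair of its carrier and its structure arrow. Arrows of algebras are
  triples (source, underlying arrow, target), since an underlying arrow does not determine the
  algebras it connects. Likewise for coalgebras.\<close>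

definition lifted_cat :: "('o, 'm) cat \<Rightarrow> ('o \<times> 'm) set \<Rightarrow> ('o \<times> 'm \<Rightarrow> 'm \<Rightarrow> 'o \<times> 'm \<Rightarrow> bool)
    \<Rightarrow> ('o \<times> 'm, ('o \<times> 'm) \<times> 'm \<times> ('o \<times> 'm)) cat" where
  "lifted_cat C X P = \<lparr>
     Obj = X,
     Arr = {(s, f, t). s \<in> X \<and> t \<in> X \<and> f \<in> Hom C (fst s) (fst t) \<and> P s f t},
     Dom = (\<lambda>(s, f, t). s),
     Cod = (\<lambda>(s, f, t). t),
     Ide = (\<lambda>s. (s, Ide C (fst s), s)),
     Comp = (\<lambda>(_, g, u) (s, f, _). (s, g \<cdot>\<^bsub>C\<^esub> f, u)) \<rparr>"

text \<open>Algebras of a monad \<open>(T, \<eta>, \<mu>)\<close> and coalgebras of a comonad \<open>(W, \<epsilon>, \<delta>)\<close> on \<open>C\<close>.\<close>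

definition EM_algebras :: "('o, 'm) cat \<Rightarrow> ('o, 'm, 'o, 'm) functr \<Rightarrow> ('o \<Rightarrow> 'm) \<Rightarrow> ('o \<Rightarrow> 'm)
    \<Rightarrow> ('o \<times> 'm, ('o \<times> 'm) \<times> 'm \<times> ('o \<times> 'm)) cat" where
  "EM_algebras C T \<eta> \<mu> = lifted_cat C
     {(x, \<alpha>). x \<in> Obj C \<and> \<alpha> \<in> Hom C (FOb T x) x
        \<and> \<alpha> \<cdot>\<^bsub>C\<^esub> \<eta> x = Ide C x \<and> \<alpha> \<cdot>\<^bsub>C\<^esub> FAr T \<alpha> = \<alpha> \<cdot>\<^bsub>C\<^esub> \<mu> x}
     (\<lambda>(_, \<alpha>) f (_, \<alpha>'). f \<cdot>\<^bsub>C\<^esub> \<alpha> = \<alpha>' \<cdot>\<^bsub>C\<^esub> FAr T f)"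

definition EM_coalgebras :: "('o, 'm) cat \<Rightarrow> ('o, 'm, 'o, 'm) functr \<Rightarrow> ('o \<Rightarrow> 'm) \<Rightarrow> ('o \<Rightarrow> 'm)
    \<Rightarrow> ('o \<times> 'm, ('o \<times> 'm) \<times> 'm \<times> ('o \<times> 'm)) cat" where
  "EM_coalgebras C W \<epsilon> \<delta> = lifted_cat C
     {(y, \<beta>). y \<in> Obj C \<and> \<beta> \<in> Hom C y (FOb W y)
        \<and> \<epsilon> y \<cdot>\<^bsub>C\<^esub> \<beta> = Ide C y \<and> FAr W \<beta> \<cdot>\<^bsub>C\<^esub> \<beta> = \<delta> y \<cdot>\<^bsub>C\<^esub> \<beta>}
     (\<lambda>(_, \<beta>) f (_, \<beta>'). FAr W f \<cdot>\<^bsub>C\<^esub> \<beta> = \<beta>' \<cdot>\<^bsub>C\<^esub> f)"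

definition forget :: "('o \<times> 'm, ('o \<times> 'm) \<times> 'm \<times> ('o \<times> 'm)) cat
    \<Rightarrow> ('o \<times> 'm, ('o \<times> 'm) \<times> 'm \<times> ('o \<times> 'm), 'o, 'm) functr" where
  "forget E = \<lparr> FOb = (\<lambda>s\<in>Obj E. fst s), FAr = (\<lambda>(s, f, t)\<in>Arr E. f) \<rparr>"

definition Alg :: "('oa, 'ma, 'ob, 'mb) adj
    \<Rightarrow> ('oa \<times> 'ma, ('oa \<times> 'ma) \<times> 'ma \<times> ('oa \<times> 'ma)) cat" where
  "Alg F = EM_algebras (Acat F) (comp_functor (Acat F) (Rad F) (Lad F)) (Unit F)
     (\<lambda>a. FAr (Rad F) (Counit F (FOb (Lad F) a)))"

definition Coalg :: "('oa, 'ma, 'ob, 'mb) adj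
    \<Rightarrow> ('ob \<times> 'mb, ('ob \<times> 'mb) \<times> 'mb \<times> ('ob \<times> 'mb)) cat" where
  "Coalg F = EM_coalgebras (Bcat F) (comp_functor (Bcat F) (Lad F) (Rad F)) (Counit F)
     (\<lambda>b. FAr (Lad F) (Unit F (FOb (Rad F) b)))"


section \<open>The nucleus of an adjunction\<close>

definition kappa0_ob :: "('oa, 'ma, 'ob, 'mb) adj \<Rightarrow> 'oa \<Rightarrow> 'ob \<times> 'mb" where
  "kappa0_ob F a = (FOb (Lad F) a, FAr (Lad F) (Unit F a))"

definition kappa0 :: "('oa, 'ma, 'ob, 'mb) adj
    \<Rightarrow> ('oa, 'ma, 'ob \<times> 'mb, ('ob \<times> 'mb) \<times> 'mb \<times> ('ob \<times> 'mb)) functr" where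
  "kappa0 F = \<lparr>
     FOb = restrict (kappa0_ob F) (Obj (Acat F)),
     FAr = (\<lambda>f\<in>Arr (Acat F).
       (kappa0_ob F (Dom (Acat F) f), FAr (Lad F) f, kappa0_ob F (Cod (Acat F) f))) \<rparr>"

definition kappa1_ob :: "('oa, 'ma, 'ob, 'mb) adj \<Rightarrow> 'ob \<Rightarrow> 'oa \<times> 'ma" where
  "kappa1_ob F b = (FOb (Rad F) b, FAr (Rad F) (Counit F b))"

definition kappa1 :: "('oa, 'ma, 'ob, 'mb) adj
    \<Rightarrow> ('ob, 'mb, 'oa \<times> 'ma, ('oa \<times> 'ma) \<times> 'ma \<times> ('oa \<times> 'ma)) functr" where
  "kappa1 F = \<lparr>
     FOb = restrict (kappa1_ob F) (Obj (Bcat F)),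
     FAr = (\<lambda>f\<in>Arr (Bcat F).
       (kappa1_ob F (Dom (Bcat F) f), FAr (Rad F) f, kappa1_ob F (Cod (Bcat F) f))) \<rparr>"

text \<open>\<open>lower_sharp F\<close> is \<open>F\<^sub>\<sharp>\<close> and \<open>upper_sharp F\<close> is \<open>F\<^sup>\<sharp>\<close>.\<close>

definition lower_sharp :: "('oa, 'ma, 'ob, 'mb) adj
    \<Rightarrow> ('oa \<times> 'ma, ('oa \<times> 'ma) \<times> 'ma \<times> ('oa \<times> 'ma),
        'ob \<times> 'mb, ('ob \<times> 'mb) \<times> 'mb \<times> ('ob \<times> 'mb)) functr" where
  "lower_sharp F = comp_functor (Alg F) (kappa0 F) (forget (Alg F))"

definition upper_sharp :: "('oa, 'ma, 'ob, 'mb) adj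
    \<Rightarrow> ('ob \<times> 'mb, ('ob \<times> 'mb) \<times> 'mb \<times> ('ob \<times> 'mb),
        'oa \<times> 'ma, ('oa \<times> 'ma) \<times> 'ma \<times> ('oa \<times> 'ma)) functr" where
  "upper_sharp F = comp_functor (Coalg F) (kappa1 F) (forget (Coalg F))"

text \<open>The correspondence \<open>Alg(F)(F\<^sup>\<sharp> \<beta>, \<alpha>) \<rightarrow> Coalg(F)(\<beta>, F\<^sub>\<sharp> \<alpha>)\<close>,
  \<open>f \<mapsto> F\<^sup>* f \<circ> \<beta>\<close>.\<close>

definition nuc_transpose :: "('oa, 'ma, 'ob, 'mb) adj \<Rightarrow> 'ob \<times> 'mb \<Rightarrow> 'oa \<times> 'ma
    \<Rightarrow> ('oa \<times> 'ma) \<times> 'ma \<times> ('oa \<times> 'ma) \<Rightarrow> ('ob \<times> 'mb) \<times> 'mb \<times> ('ob \<times> 'mb)" where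
  "nuc_transpose F \<beta> \<alpha> = (\<lambda>(_, f, _).
     (\<beta>, FAr (Lad F) f \<cdot>\<^bsub>Bcat F\<^esub> snd \<beta>, FOb (lower_sharp F) \<alpha>))"

text \<open>Unit and counit are the transposes of the identities of \<open>F\<^sup>\<sharp> \<beta>\<close> and \<open>F\<^sub>\<sharp> \<alpha>\<close>.\<close>

definition nuc_unit :: "('oa, 'ma, 'ob, 'mb) adj
    \<Rightarrow> 'ob \<times> 'mb \<Rightarrow> ('ob \<times> 'mb) \<times> 'mb \<times> ('ob \<times> 'mb)" where
  "nuc_unit F = (\<lambda>\<beta>\<in>Obj (Coalg F).
     nuc_transpose F \<beta> (FOb (upper_sharp F) \<beta>) (Ide (Alg F) (FOb (upper_sharp F) \<beta>)))"

definition nuc_counit :: "('oa, 'ma, 'ob, 'mb) adj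
    \<Rightarrow> 'oa \<times> 'ma \<Rightarrow> ('oa \<times> 'ma) \<times> 'ma \<times> ('oa \<times> 'ma)" where
  "nuc_counit F = (\<lambda>\<alpha>\<in>Obj (Alg F).
     inv_into (Hom (Alg F) (FOb (upper_sharp F) (FOb (lower_sharp F) \<alpha>)) \<alpha>)
       (nuc_transpose F (FOb (lower_sharp F) \<alpha>) \<alpha>)
       (Ide (Coalg F) (FOb (lower_sharp F) \<alpha>)))"

definition Nuc :: "('oa, 'ma, 'ob, 'mb) adj
    \<Rightarrow> ('ob \<times> 'mb, ('ob \<times> 'mb) \<times> 'mb \<times> ('ob \<times> 'mb),
        'oa \<times> 'ma, ('oa \<times> 'ma) \<times> 'ma \<times> ('oa \<times> 'ma)) adj" where
  "Nuc F = \<lparr> Acat = Coalg F, Bcat = Alg F, Lad = upper_sharp F, Rad = lower_sharp F,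
     Unit = nuc_unit F, Counit = nuc_counit F \<rparr>"


section \<open>The nucleus of a morphism of adjunctions\<close>

definition K_ups_ob :: "('oa, 'ma, 'ob, 'mb) adj \<Rightarrow> ('oc, 'mc, 'od, 'md) adj
    \<Rightarrow> ('oa, 'ma, 'ob, 'mb, 'oc, 'mc, 'od, 'md) adj_mor \<Rightarrow> 'ob \<times> 'mb \<Rightarrow> 'od \<times> 'md" where
  "K_ups_ob F G Y = (\<lambda>(b, \<beta>). (FOb (MK Y) b,
     FAr (Lad G) (upR Y b) \<cdot>\<^bsub>Bcat G\<^esub> upL Y (FOb (Rad F) b) \<cdot>\<^bsub>Bcat G\<^esub> FAr (MK Y) \<beta>))"

definition K_ups :: "('oa, 'ma, 'ob, 'mb) adj \<Rightarrow> ('oc, 'mc, 'od, 'md) adj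
    \<Rightarrow> ('oa, 'ma, 'ob, 'mb, 'oc, 'mc, 'od, 'md) adj_mor
    \<Rightarrow> ('ob \<times> 'mb, ('ob \<times> 'mb) \<times> 'mb \<times> ('ob \<times> 'mb),
        'od \<times> 'md, ('od \<times> 'md) \<times> 'md \<times> ('od \<times> 'md)) functr" where
  "K_ups F G Y = \<lparr>
     FOb = restrict (K_ups_ob F G Y) (Obj (Coalg F)),
     FAr = (\<lambda>(s, f, t)\<in>Arr (Coalg F). (K_ups_ob F G Y s, FAr (MK Y) f, K_ups_ob F G Y t)) \<rparr>"

definition H_ups_ob :: "('oa, 'ma, 'ob, 'mb) adj \<Rightarrow> ('oc, 'mc, 'od, 'md) adj
    \<Rightarrow> ('oa, 'ma, 'ob, 'mb, 'oc, 'mc, 'od, 'md) adj_mor \<Rightarrow> 'oa \<times> 'ma \<Rightarrow> 'oc \<times> 'mc" where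
  "H_ups_ob F G Y = (\<lambda>(a, \<alpha>). (FOb (MH Y) a,
     FAr (MH Y) \<alpha> \<cdot>\<^bsub>Acat G\<^esub> inv_arrow (Acat G) (upR Y (FOb (Lad F) a))
       \<cdot>\<^bsub>Acat G\<^esub> inv_arrow (Acat G) (FAr (Rad G) (upL Y a))))"

definition H_ups :: "('oa, 'ma, 'ob, 'mb) adj \<Rightarrow> ('oc, 'mc, 'od, 'md) adj
    \<Rightarrow> ('oa, 'ma, 'ob, 'mb, 'oc, 'mc, 'od, 'md) adj_mor
    \<Rightarrow> ('oa \<times> 'ma, ('oa \<times> 'ma) \<times> 'ma \<times> ('oa \<times> 'ma),
        'oc \<times> 'mc, ('oc \<times> 'mc) \<times> 'mc \<times> ('oc \<times> 'mc)) functr" where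
  "H_ups F G Y = \<lparr>
     FOb = restrict (H_ups_ob F G Y) (Obj (Alg F)),
     FAr = (\<lambda>(s, f, t)\<in>Arr (Alg F). (H_ups_ob F G Y s, FAr (MH Y) f, H_ups_ob F G Y t)) \<rparr>"

text \<open>\<open>ups_upper_sharp\<close> is \<open>\<upsilon>\<^sup>\<sharp> : H\<^sup>\<upsilon> F\<^sup>\<sharp> \<rightarrow> G\<^sup>\<sharp> K\<^sup>\<upsilon>\<close> and
  \<open>ups_lower_sharp\<close> is \<open>\<upsilon>\<^sub>\<sharp> : K\<^sup>\<upsilon> F\<^sub>\<sharp> \<rightarrow> G\<^sub>\<sharp> H\<^sup>\<upsilon>\<close>.\<close>

definition ups_upper_sharp :: "('oa, 'ma, 'ob, 'mb) adj \<Rightarrow> ('oc, 'mc, 'od, 'md) adj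
    \<Rightarrow> ('oa, 'ma, 'ob, 'mb, 'oc, 'mc, 'od, 'md) adj_mor
    \<Rightarrow> 'ob \<times> 'mb \<Rightarrow> ('oc \<times> 'mc) \<times> 'mc \<times> ('oc \<times> 'mc)" where
  "ups_upper_sharp F G Y = (\<lambda>\<beta>\<in>Obj (Coalg F).
     (FOb (H_ups F G Y) (FOb (upper_sharp F) \<beta>), upR Y (fst \<beta>),
      FOb (upper_sharp G) (FOb (K_ups F G Y) \<beta>)))"

definition ups_lower_sharp :: "('oa, 'ma, 'ob, 'mb) adj \<Rightarrow> ('oc, 'mc, 'od, 'md) adj
    \<Rightarrow> ('oa, 'ma, 'ob, 'mb, 'oc, 'mc, 'od, 'md) adj_mor
    \<Rightarrow> 'oa \<times> 'ma \<Rightarrow> ('od \<times> 'md) \<times> 'md \<times> ('od \<times> 'md)" where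
  "ups_lower_sharp F G Y = (\<lambda>\<alpha>\<in>Obj (Alg F).
     (FOb (K_ups F G Y) (FOb (lower_sharp F) \<alpha>), upL Y (fst \<alpha>),
      FOb (lower_sharp G) (FOb (H_ups F G Y) \<alpha>)))"

definition Nuc_mor :: "('oa, 'ma, 'ob, 'mb) adj \<Rightarrow> ('oc, 'mc, 'od, 'md) adj
    \<Rightarrow> ('oa, 'ma, 'ob, 'mb, 'oc, 'mc, 'od, 'md) adj_mor
    \<Rightarrow> ('ob \<times> 'mb, ('ob \<times> 'mb) \<times> 'mb \<times> ('ob \<times> 'mb),
        'oa \<times> 'ma, ('oa \<times> 'ma) \<times> 'ma \<times> ('oa \<times> 'ma),
        'od \<times> 'md, ('od \<times> 'md) \<times> 'md \<times> ('od \<times> 'md),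
        'oc \<times> 'mc, ('oc \<times> 'mc) \<times> 'mc \<times> ('oc \<times> 'mc)) adj_mor" where
  "Nuc_mor F G Y = \<lparr> MH = K_ups F G Y, MK = H_ups F G Y,
     upL = ups_upper_sharp F G Y, upR = ups_lower_sharp F G Y \<rparr>"

definition Nuc_functor where
  "Nuc_functor = \<lparr>
     FOb = (\<lambda>F\<in>Obj Adj. Nuc F),
     FAr = (\<lambda>(F, Y, G)\<in>Arr Adj. (Nuc F, Nuc_mor F G Y, Nuc G)) \<rparr>"

end

theory Submission
  imports Defs
begin

text \<open>An algebra structure \<open>\<alpha>\<close> on \<open>x\<close> is a retraction of \<open>\<eta>\<^sub>x\<close>, and a coalgebra structure \<open>\<beta>\<close> on \<open>y\<close>
  is a section of \<open>\<epsilon>\<^sub>y\<close>. Hence \<open>f \<mapsto> F\<^sup>*f \<circ> \<beta>\<close> has the inverse \<open>g \<mapsto> \<alpha> \<circ> F\<^sub>*g\<close>, and the unit and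
  counit of the nucleus are the structure arrows \<open>\<beta>\<close> and \<open>\<alpha>\<close> themselves.
  A morphism of adjunctions carries the monad and the comonad of \<open>F\<close> to those of \<open>G\<close> up to
  isomorphism; transporting structure arrows along these isomorphisms gives \<open>H\<^sup>\<upsilon>\<close> and \<open>K\<^sup>\<upsilon>\<close>. The
  unit condition for \<open>Nuc(\<Upsilon>)\<close> at \<open>\<beta>\<close> is then the definition of \<open>K\<^sup>\<upsilon>\<beta>\<close>, and its counit condition at
  \<open>\<alpha>\<close> is the definition of \<open>H\<^sup>\<upsilon>\<alpha>\<close>.\<close>

section \<open>Categories in terms of arrows, domains and codomains\<close>

lemma mem_Hom: "f \<in> Hom C x y \<longleftrightarrow> f \<in> Arr C \<and> Dom C f = x \<and> Cod C f = y"
  by (auto simp: Hom_def)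

context category
begin

declare Dom_Obj [simp] Cod_Obj [simp]

text \<open>The \<open>Hom\<close> premises of the axioms mention intermediate objects that matching
  cannot find. Restated through \<open>Arr\<close>, \<open>Dom\<close> and \<open>Cod\<close>, the
  side conditions of each law can be computed from the arrows themselves.\<close>

lemma Ide_arrow [simp]:
  assumes "x \<in> Obj C"
  shows "Ide C x \<in> Arr C" "Dom C (Ide C x) = x" "Cod C (Ide C x) = x"
  using Ide_Hom[OF assms] by (auto simp: mem_Hom)

lemma Comp_arrow [simp]:
  assumes "f \<in> Arr C" "g \<in> Arr C" "Dom C g = Cod C f"
  shows "g \<cdot> f \<in> Arr C" "Dom C (g \<cdot> f) = Dom C f" "Cod C (g \<cdot> f) = Cod C g"
  using Comp_Hom[of f "Dom C f" "Cod C f" g "Cod C g"] assms by (auto simp: mem_Hom)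

lemma Comp_Ide_arrow [simp]: "f \<in> Arr C \<Longrightarrow> Dom C f = x \<Longrightarrow> f \<cdot> Ide C x = f"
  using Comp_Ide[of f x "Cod C f"] by (auto simp: mem_Hom)

lemma Ide_Comp_arrow [simp]: "f \<in> Arr C \<Longrightarrow> Cod C f = y \<Longrightarrow> Ide C y \<cdot> f = f"
  using Ide_Comp[of f "Dom C f" y] by (auto simp: mem_Hom)

lemma Comp_assoc_arrow [simp]:
  assumes "f \<in> Arr C" "g \<in> Arr C" "h \<in> Arr C" "Dom C g = Cod C f" "Dom C h = Cod C g"
  shows "(h \<cdot> g) \<cdot> f = h \<cdot> (g \<cdot> f)"
  using Comp_assoc[of f "Dom C f" "Cod C f" g "Cod C g" h "Cod C h"] assms by (auto simp: mem_Hom)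

text \<open>Composites are kept bracketed to the right, so a factor pair \<open>h \<cdot> g\<close>
  inside a longer composite is hidden behind its tail \<open>f\<close>. This form makes an equation
  about the pair applicable there; most diagram pastings below use it.\<close>

lemma Comp_extend:
  assumes "h \<cdot> g = k" "f \<in> Arr C" "g \<in> Arr C" "h \<in> Arr C" "Dom C g = Cod C f" "Dom C h = Cod C g"
  shows "h \<cdot> (g \<cdot> f) = k \<cdot> f"
  using Comp_assoc_arrow[of f g h] assms by simp

lemma inverse_arrows_unique:
  assumes "inverse_arrows C f g" "inverse_arrows C f h"
  shows "g = h"
proof -
  have f: "f \<in> Arr C" and g: "g \<in> Arr C" "Dom C g = Cod C f" "Cod C g = Dom C f"
    and h: "h \<in> Arr C" "Dom C h = Cod C f" "Cod C h = Dom C f"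
    and gf: "g \<cdot> f = Ide C (Dom C f)" and fh: "f \<cdot> h = Ide C (Cod C f)"
    using assms by (auto simp: inverse_arrows_def mem_Hom)
  have "g = g \<cdot> (f \<cdot> h)" using f g fh by simp
  also have "\<dots> = (g \<cdot> f) \<cdot> h" using f g h by simp
  also have "\<dots> = h" using f h gf by simp
  finally show ?thesis .
qed

lemma inv_arrow_eqI: "inverse_arrows C f g \<Longrightarrow> inv_arrow C f = g"
  unfolding inv_arrow_def by (rule the_equality) (auto intro: inverse_arrows_unique)

lemma inverse_arrows_inv_arrow: "iso_arrow C f \<Longrightarrow> inverse_arrows C f (inv_arrow C f)"
  by (auto simp: iso_arrow_def inv_arrow_eqI)

lemma inv_arrow [simp]:
  assumes "iso_arrow C f"
  shows "inv_arrow C f \<in> Arr C" "Dom C (inv_arrow C f) = Cod C f" "Cod C (inv_arrow C f) = Dom C f"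
    "inv_arrow C f \<cdot> f = Ide C (Dom C f)" "f \<cdot> inv_arrow C f = Ide C (Cod C f)"
  using inverse_arrows_inv_arrow[OF assms] by (auto simp: inverse_arrows_def mem_Hom)

lemma iso_arrow_Arr: "iso_arrow C f \<Longrightarrow> f \<in> Arr C"
  by (auto simp: iso_arrow_def inverse_arrows_def)

lemma inv_arrow_cancel [simp]:
  assumes "iso_arrow C f" "h \<in> Arr C"
  shows "Cod C h = Dom C f \<Longrightarrow> inv_arrow C f \<cdot> f \<cdot> h = h"
    and "Cod C h = Cod C f \<Longrightarrow> f \<cdot> inv_arrow C f \<cdot> h = h"
  using assms iso_arrow_Arr[OF assms(1)]
  by (simp_all flip: Comp_assoc_arrow)

text \<open>Cancel \<open>d\<close> on the left and \<open>e\<close> on the right of the commuting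
  square. This turns naturality and homomorphism squares into squares for the inverse
  arrows.\<close>

lemma inv_arrow_square:
  assumes "d \<cdot> h = k \<cdot> e" "iso_arrow C d" "iso_arrow C e" "h \<in> Arr C" "k \<in> Arr C"
    and "Dom C d = Cod C h" "Dom C k = Cod C e" "Dom C h = Dom C e"
  shows "h \<cdot> inv_arrow C e = inv_arrow C d \<cdot> k"
proof -
  note [simp] = iso_arrow_Arr[OF assms(2)] iso_arrow_Arr[OF assms(3)] assms(2-8)
  \<comment> \<open>The codomain of \<open>k\<close> is not among the typing premises; taking
    codomains on both sides of the square supplies it.\<close>
  have "Cod C d = Cod C k"
    using arg_cong[OF assms(1), of "Cod C"] by simp
  have "h \<cdot> inv_arrow C e = inv_arrow C d \<cdot> (d \<cdot> h) \<cdot> inv_arrow C e"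
    by simp
  also have "\<dots> = inv_arrow C d \<cdot> k"
    unfolding assms(1) using \<open>Cod C d = Cod C k\<close> by simp
  finally show ?thesis .
qed

lemma inverse_arrows_Ide: "x \<in> Obj C \<Longrightarrow> inverse_arrows C (Ide C x) (Ide C x)"
  by (simp add: inverse_arrows_def mem_Hom)

lemma inv_arrow_Ide [simp]: "x \<in> Obj C \<Longrightarrow> inv_arrow C (Ide C x) = Ide C x"
  by (simp add: inv_arrow_eqI inverse_arrows_Ide)

lemma iso_arrow_Ide [simp]: "x \<in> Obj C \<Longrightarrow> iso_arrow C (Ide C x)"
  using inverse_arrows_Ide by (auto simp: iso_arrow_def)

lemma inverse_arrows_Comp:
  assumes "iso_arrow C f" "iso_arrow C g" "Dom C g = Cod C f"
  shows "inverse_arrows C (g \<cdot> f) (inv_arrow C f \<cdot> inv_arrow C g)"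
  using assms iso_arrow_Arr[OF assms(1)] iso_arrow_Arr[OF assms(2)]
  by (simp add: inverse_arrows_def mem_Hom)

lemma inv_arrow_Comp [simp]:
  assumes "iso_arrow C f" "iso_arrow C g" "Dom C g = Cod C f"
  shows "inv_arrow C (g \<cdot> f) = inv_arrow C f \<cdot> inv_arrow C g"
  by (rule inv_arrow_eqI) (rule inverse_arrows_Comp[OF assms])

lemma iso_arrow_Comp [simp]:
  assumes "iso_arrow C f" "iso_arrow C g" "Dom C g = Cod C f"
  shows "iso_arrow C (g \<cdot> f)"
  using inverse_arrows_Comp[OF assms] by (auto simp: iso_arrow_def)

end

section \<open>Functors and natural transformations in terms of arrows\<close>

context cat_functor
begin

declare FOb_Obj [simp] FAr_Ide [simp]

lemma FAr_arrow [simp]: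
  assumes "f \<in> Arr A"
  shows "FAr T f \<in> Arr B" "Dom B (FAr T f) = FOb T (Dom A f)" "Cod B (FAr T f) = FOb T (Cod A f)"
  using FAr_Hom[of f "Dom A f" "Cod A f"] assms by (auto simp: mem_Hom)

lemma FAr_Comp_arrow [simp]:
  "f \<in> Arr A \<Longrightarrow> g \<in> Arr A \<Longrightarrow> Dom A g = Cod A f \<Longrightarrow> FAr T (g \<cdot>\<^bsub>A\<^esub> f) = FAr T g \<cdot>\<^bsub>B\<^esub> FAr T f"
  using FAr_Comp[of f "Dom A f" "Cod A f" g "Cod A g"] by (auto simp: mem_Hom)

lemma FAr_inverse_arrows:
  assumes "iso_arrow A f"
  shows "inverse_arrows B (FAr T f) (FAr T (inv_arrow A f))"
  using assms src.iso_arrow_Arr[OF assms]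
  by (simp add: inverse_arrows_def mem_Hom flip: FAr_Comp_arrow)

lemma FAr_iso_arrow [simp]: "iso_arrow A f \<Longrightarrow> iso_arrow B (FAr T f)"
  using FAr_inverse_arrows by (auto simp: iso_arrow_def)

lemma FAr_inv_arrow [simp]: "iso_arrow A f \<Longrightarrow> FAr T (inv_arrow A f) = inv_arrow B (FAr T f)"
  using tgt.inv_arrow_eqI[OF FAr_inverse_arrows] by simp

end

lemma cat_functorI:
  assumes "category A" "category B"
    and "\<And>x. x \<in> Obj A \<Longrightarrow> FOb T x \<in> Obj B"
    and "\<And>f. f \<in> Arr A \<Longrightarrow>
      FAr T f \<in> Arr B \<and> Dom B (FAr T f) = FOb T (Dom A f) \<and> Cod B (FAr T f) = FOb T (Cod A f)"
    and "\<And>x. x \<in> Obj A \<Longrightarrow> FAr T (Ide A x) = Ide B (FOb T x)"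
    and "\<And>f g. f \<in> Arr A \<Longrightarrow> g \<in> Arr A \<Longrightarrow> Dom A g = Cod A f
      \<Longrightarrow> FAr T (g \<cdot>\<^bsub>A\<^esub> f) = FAr T g \<cdot>\<^bsub>B\<^esub> FAr T f"
    and "FOb T \<in> extensional (Obj A)" "FAr T \<in> extensional (Arr A)"
  shows "cat_functor A B T"
  using assms by (auto simp: cat_functor_def cat_functor_axioms_def mem_Hom)

lemma nat_transformationI:
  assumes "cat_functor A B S" "cat_functor A B T"
    and "\<And>x. x \<in> Obj A \<Longrightarrow> \<tau> x \<in> Arr B \<and> Dom B (\<tau> x) = FOb S x \<and> Cod B (\<tau> x) = FOb T x"
    and "\<And>f. f \<in> Arr A \<Longrightarrow> FAr T f \<cdot>\<^bsub>B\<^esub> \<tau> (Dom A f) = \<tau> (Cod A f) \<cdot>\<^bsub>B\<^esub> FAr S f"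
    and "\<tau> \<in> extensional (Obj A)"
  shows "nat_transformation A B S T \<tau>"
  using assms by (auto simp: nat_transformation_def nat_transformation_axioms_def mem_Hom)

context nat_transformation
begin

lemma component_arrow:
  assumes "x \<in> Obj A"
  shows "\<tau> x \<in> Arr B" "Dom B (\<tau> x) = FOb S x" "Cod B (\<tau> x) = FOb T x"
  using component_Hom[OF assms] by (auto simp: mem_Hom)

lemma naturality_arrow: "f \<in> Arr A \<Longrightarrow> FAr T f \<cdot>\<^bsub>B\<^esub> \<tau> (Dom A f) = \<tau> (Cod A f) \<cdot>\<^bsub>B\<^esub> FAr S f"
  using naturality[of f "Dom A f" "Cod A f"] by (auto simp: mem_Hom)

end

section \<open>Identity and composite functors\<close>

lemma id_functor_apply [simp]:
  "x \<in> Obj A \<Longrightarrow> FOb (id_functor A) x = x" "f \<in> Arr A \<Longrightarrow> FAr (id_functor A) f = f"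
  by (simp_all add: id_functor_def)

lemma comp_functor_apply [simp]:
  "x \<in> Obj A \<Longrightarrow> FOb (comp_functor A S T) x = FOb S (FOb T x)"
  "f \<in> Arr A \<Longrightarrow> FAr (comp_functor A S T) f = FAr S (FAr T f)"
  by (simp_all add: comp_functor_def compose_def)

lemma comp_functor_extensional [simp]:
  "FOb (comp_functor A S T) \<in> extensional (Obj A)" "FAr (comp_functor A S T) \<in> extensional (Arr A)"
  by (simp_all add: comp_functor_def)

lemma cat_functor_id:
  assumes "category A"
  shows "cat_functor A A (id_functor A)"
proof -
  interpret category A by fact
  show ?thesis
    by (rule cat_functorI) (simp_all add: assms, simp_all add: id_functor_def)
qed

lemma cat_functor_comp:
  assumes "cat_functor A B T" "cat_functor B C S"
  shows "cat_functor A C (comp_functor A S T)"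
proof -
  interpret T: cat_functor A B T by fact
  interpret S: cat_functor B C S by fact
  show ?thesis
    by (rule cat_functorI) (simp_all add: T.src.category_axioms S.tgt.category_axioms)
qed

text \<open>Functors are extensional on their source carriers, so agreement there is already
  equality of HOL functions.\<close>

lemma functr_eqI:
  fixes S T :: "('o, 'm, 'p, 'n) functr"
  assumes "cat_functor A B S" "cat_functor A B T"
    and "\<And>x. x \<in> Obj A \<Longrightarrow> FOb S x = FOb T x" "\<And>f. f \<in> Arr A \<Longrightarrow> FAr S f = FAr T f"
  shows "S = T"
proof (rule functr.equality)
  show "FOb S = FOb T"
    using assms by (intro extensionalityI[of _ "Obj A"]) (auto simp: cat_functor_def cat_functor_axioms_def)
  show "FAr S = FAr T"
    using assms by (intro extensionalityI[of _ "Arr A"]) (auto simp: cat_functor_def cat_functor_axioms_def)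
qed simp

lemma comp_functor_id:
  assumes "cat_functor A B T"
  shows "comp_functor A T (id_functor A) = T" "comp_functor A (id_functor B) T = T"
proof -
  interpret cat_functor A B T by fact
  note id = cat_functor_id[OF src.category_axioms] cat_functor_id[OF tgt.category_axioms]
  show "comp_functor A T (id_functor A) = T"
    by (rule functr_eqI[of A B]) (auto intro: cat_functor_comp id assms)
  show "comp_functor A (id_functor B) T = T"
    by (rule functr_eqI[of A B]) (auto intro: cat_functor_comp id assms)
qed

text \<open>\<open>T\<close> maps the carriers of \<open>A\<close> into those of \<open>B\<close>,
  so the restriction to \<open>B\<close> built into the inner composite is invisible after
  \<open>T\<close>.\<close>

lemma comp_functor_assoc:
  assumes "cat_functor A B T"
  shows "comp_functor A (comp_functor B U S) T = comp_functor A U (comp_functor A S T)"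
proof -
  interpret cat_functor A B T by fact
  show ?thesis
    by (simp add: comp_functor_def fun_eq_iff compose_def restrict_def)
qed

section \<open>Lifted categories\<close>

lemma lifted_cat_simps [simp]:
  "Obj (lifted_cat C X P) = X"
  "(s, f, t) \<in> Arr (lifted_cat C X P) \<longleftrightarrow>
    s \<in> X \<and> t \<in> X \<and> f \<in> Arr C \<and> Dom C f = fst s \<and> Cod C f = fst t \<and> P s f t"
  "Dom (lifted_cat C X P) (s, f, t) = s"
  "Cod (lifted_cat C X P) (s, f, t) = t"
  "Ide (lifted_cat C X P) s = (s, Ide C (fst s), s)"
  "(t', g, u) \<cdot>\<^bsub>lifted_cat C X P\<^esub> (s, f, t) = (s, g \<cdot>\<^bsub>C\<^esub> f, u)"
  by (auto simp: lifted_cat_def mem_Hom)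

text \<open>The category laws come from \<open>C\<close> through the underlying arrows; what has to
  be supplied is that \<open>P\<close> admits identities and is stable under composition.\<close>

lemma category_lifted_cat:
  assumes "category C"
    and "\<And>s. s \<in> X \<Longrightarrow> fst s \<in> Obj C"
    and "\<And>s. s \<in> X \<Longrightarrow> P s (Ide C (fst s)) s"
    and "\<And>s t u f g. s \<in> X \<Longrightarrow> t \<in> X \<Longrightarrow> u \<in> X \<Longrightarrow> f \<in> Hom C (fst s) (fst t)
      \<Longrightarrow> g \<in> Hom C (fst t) (fst u) \<Longrightarrow> P s f t \<Longrightarrow> P t g u \<Longrightarrow> P s (g \<cdot>\<^bsub>C\<^esub> f) u"
  shows "category (lifted_cat C X P)"
proof -
  interpret category C by fact
  show ?thesis
    by unfold_locales (use assms in \<open>auto simp: mem_Hom\<close>)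
qed

lemma cat_functor_forget:
  assumes "category C" "category (lifted_cat C X P)" "\<And>s. s \<in> X \<Longrightarrow> fst s \<in> Obj C"
  shows "cat_functor (lifted_cat C X P) C (forget (lifted_cat C X P))"
proof -
  interpret category C by fact
  interpret L: category "lifted_cat C X P" by fact
  show ?thesis
    by (rule cat_functorI)
      (use assms L.Ide_arrow(1) L.Comp_arrow(1) in \<open>auto simp: forget_def extensional_def\<close>)
qed

lemma iso_arrow_lifted_cat:
  assumes "category C" "(s, f, t) \<in> Arr (lifted_cat C X P)" "iso_arrow C f" "P t (inv_arrow C f) s"
  shows "iso_arrow (lifted_cat C X P) (s, f, t)"
proof -
  interpret category C by fact
  have "inverse_arrows (lifted_cat C X P) (s, f, t) (t, inv_arrow C f, s)"
    using assms by (simp add: inverse_arrows_def mem_Hom)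
  then show ?thesis
    unfolding iso_arrow_def by blast
qed

section \<open>Eilenberg-Moore categories\<close>

lemma category_EM_algebras:
  assumes "cat_functor C C T"
  shows "category (EM_algebras C T \<eta> \<mu>)"
proof -
  interpret T: cat_functor C C T by fact
  show ?thesis
    unfolding EM_algebras_def
  proof (rule category_lifted_cat[OF T.src.category_axioms], goal_cases)
    \<comment> \<open>Stability under composition: the homomorphism squares of \<open>f\<close> and
      \<open>g\<close> are pasted, with functoriality of \<open>T\<close> joining their
      \<open>T\<close>-sides.\<close>
    case (3 s t u f g)
    obtain x \<alpha> y \<beta> z \<gamma> where stu: "s = (x, \<alpha>)" "t = (y, \<beta>)" "u = (z, \<gamma>)"
      by (metis surj_pair)
    from 3 have eq: "f \<cdot>\<^bsub>C\<^esub> \<alpha> = \<beta> \<cdot>\<^bsub>C\<^esub> FAr T f" "g \<cdot>\<^bsub>C\<^esub> \<beta> = \<gamma> \<cdot>\<^bsub>C\<^esub> FAr T g"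
      by (simp_all add: stu)
    from 3 show ?case
      by (simp add: stu mem_Hom eq T.src.Comp_extend[OF eq(2)])
  qed (auto simp: mem_Hom)
qed

lemma category_EM_coalgebras:
  assumes "cat_functor C C W"
  shows "category (EM_coalgebras C W \<epsilon> \<delta>)"
proof -
  interpret W: cat_functor C C W by fact
  show ?thesis
    unfolding EM_coalgebras_def
  proof (rule category_lifted_cat[OF W.src.category_axioms], goal_cases)
    case (3 s t u f g)
    obtain x \<alpha> y \<beta> z \<gamma> where stu: "s = (x, \<alpha>)" "t = (y, \<beta>)" "u = (z, \<gamma>)"
      by (metis surj_pair)
    from 3 have eq: "FAr W f \<cdot>\<^bsub>C\<^esub> \<alpha> = \<beta> \<cdot>\<^bsub>C\<^esub> f" "FAr W g \<cdot>\<^bsub>C\<^esub> \<beta> = \<gamma> \<cdot>\<^bsub>C\<^esub> g"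
      by (simp_all add: stu)
    from 3 show ?case
      by (simp add: stu mem_Hom eq W.src.Comp_extend[OF eq(2)])
  qed (auto simp: mem_Hom)
qed

text \<open>The forgetful functor reflects isomorphisms: inverting both \<open>f\<close> and
  \<open>FAr T f\<close> in the homomorphism square shows that the inverse of \<open>f\<close> is
  again a homomorphism.\<close>

lemma iso_arrow_EM_algebras:
  assumes "cat_functor C C T" "(s, f, t) \<in> Arr (EM_algebras C T \<eta> \<mu>)" "iso_arrow C f"
  shows "iso_arrow (EM_algebras C T \<eta> \<mu>) (s, f, t)"
proof -
  interpret T: cat_functor C C T by fact
  obtain x \<alpha> y \<beta> where st: "s = (x, \<alpha>)" "t = (y, \<beta>)"
    by (metis surj_pair)
  have "\<alpha> \<cdot>\<^bsub>C\<^esub> inv_arrow C (FAr T f) = inv_arrow C f \<cdot>\<^bsub>C\<^esub> \<beta>"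
    by (rule T.src.inv_arrow_square) (use assms in \<open>auto simp: EM_algebras_def st mem_Hom\<close>)
  then show ?thesis
    using assms unfolding EM_algebras_def
    by (intro iso_arrow_lifted_cat T.src.category_axioms) (simp_all add: st)
qed

lemma iso_arrow_EM_coalgebras:
  assumes "cat_functor C C W" "(s, f, t) \<in> Arr (EM_coalgebras C W \<epsilon> \<delta>)" "iso_arrow C f"
  shows "iso_arrow (EM_coalgebras C W \<epsilon> \<delta>) (s, f, t)"
proof -
  interpret W: cat_functor C C W by fact
  obtain x \<alpha> y \<beta> where st: "s = (x, \<alpha>)" "t = (y, \<beta>)"
    by (metis surj_pair)
  have "\<alpha> \<cdot>\<^bsub>C\<^esub> inv_arrow C f = inv_arrow C (FAr W f) \<cdot>\<^bsub>C\<^esub> \<beta>"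
    by (rule W.src.inv_arrow_square) (use assms in \<open>auto simp: EM_coalgebras_def st mem_Hom\<close>)
  then show ?thesis
    using assms unfolding EM_coalgebras_def
    by (intro iso_arrow_lifted_cat W.src.category_axioms) (simp_all add: st)
qed

section \<open>The nucleus of an adjunction\<close>

context adjunction
begin

sublocale L: cat_functor "Acat F" "Bcat F" "Lad F"
  by (rule Lad_functor)

sublocale R: cat_functor "Bcat F" "Acat F" "Rad F"
  by (rule Rad_functor)

lemma Unit_arrow [simp]:
  assumes "a \<in> Obj (Acat F)"
  shows "Unit F a \<in> Arr (Acat F)" "Dom (Acat F) (Unit F a) = a"
    "Cod (Acat F) (Unit F a) = FOb (Rad F) (FOb (Lad F) a)"
  using nat_transformation.component_arrow[OF Unit_natural assms] assms by simp_all

lemma Counit_arrow [simp]: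
  assumes "b \<in> Obj (Bcat F)"
  shows "Counit F b \<in> Arr (Bcat F)" "Dom (Bcat F) (Counit F b) = FOb (Lad F) (FOb (Rad F) b)"
    "Cod (Bcat F) (Counit F b) = b"
  using nat_transformation.component_arrow[OF Counit_natural assms] assms by simp_all

lemma Unit_naturality:
  "f \<in> Arr (Acat F) \<Longrightarrow> FAr (Rad F) (FAr (Lad F) f) \<cdot>\<^bsub>Acat F\<^esub> Unit F (Dom (Acat F) f)
    = Unit F (Cod (Acat F) f) \<cdot>\<^bsub>Acat F\<^esub> f"
  using nat_transformation.naturality_arrow[OF Unit_natural] by simp

lemma Counit_naturality:
  "g \<in> Arr (Bcat F) \<Longrightarrow> Counit F (Cod (Bcat F) g) \<cdot>\<^bsub>Bcat F\<^esub> FAr (Lad F) (FAr (Rad F) g)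
    = g \<cdot>\<^bsub>Bcat F\<^esub> Counit F (Dom (Bcat F) g)"
  using nat_transformation.naturality_arrow[OF Counit_natural] by simp

declare triangle_Lad [simp] triangle_Rad [simp]

section \<open>Algebras and coalgebras of the adjunction\<close>

lemma Alg_simps [simp]:
  "Dom (Alg F) (s, f, t) = s"
  "Cod (Alg F) (s, f, t) = t"
  "Ide (Alg F) s = (s, Ide (Acat F) (fst s), s)"
  "(t', g, u) \<cdot>\<^bsub>Alg F\<^esub> (s, f, t) = (s, g \<cdot>\<^bsub>Acat F\<^esub> f, u)"
  by (simp_all add: Alg_def EM_algebras_def)

lemma Coalg_simps [simp]:
  "Dom (Coalg F) (s, f, t) = s"
  "Cod (Coalg F) (s, f, t) = t"
  "Ide (Coalg F) s = (s, Ide (Bcat F) (fst s), s)"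
  "(t', g, u) \<cdot>\<^bsub>Coalg F\<^esub> (s, f, t) = (s, g \<cdot>\<^bsub>Bcat F\<^esub> f, u)"
  by (simp_all add: Coalg_def EM_coalgebras_def)

lemma Obj_Alg:
  "(x, \<alpha>) \<in> Obj (Alg F) \<longleftrightarrow> x \<in> Obj (Acat F) \<and> \<alpha> \<in> Arr (Acat F)
    \<and> Dom (Acat F) \<alpha> = FOb (Rad F) (FOb (Lad F) x) \<and> Cod (Acat F) \<alpha> = x
    \<and> \<alpha> \<cdot>\<^bsub>Acat F\<^esub> Unit F x = Ide (Acat F) x
    \<and> \<alpha> \<cdot>\<^bsub>Acat F\<^esub> FAr (Rad F) (FAr (Lad F) \<alpha>)
      = \<alpha> \<cdot>\<^bsub>Acat F\<^esub> FAr (Rad F) (Counit F (FOb (Lad F) x))"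
  by (auto simp: Alg_def EM_algebras_def mem_Hom)

lemma Obj_Coalg:
  "(y, \<beta>) \<in> Obj (Coalg F) \<longleftrightarrow> y \<in> Obj (Bcat F) \<and> \<beta> \<in> Arr (Bcat F)
    \<and> Dom (Bcat F) \<beta> = y \<and> Cod (Bcat F) \<beta> = FOb (Lad F) (FOb (Rad F) y)
    \<and> Counit F y \<cdot>\<^bsub>Bcat F\<^esub> \<beta> = Ide (Bcat F) y
    \<and> FAr (Lad F) (FAr (Rad F) \<beta>) \<cdot>\<^bsub>Bcat F\<^esub> \<beta>
      = FAr (Lad F) (Unit F (FOb (Rad F) y)) \<cdot>\<^bsub>Bcat F\<^esub> \<beta>"
  by (auto simp: Coalg_def EM_coalgebras_def mem_Hom)

lemma Arr_Alg:
  "(s, f, t) \<in> Arr (Alg F) \<longleftrightarrow> s \<in> Obj (Alg F) \<and> t \<in> Obj (Alg F) \<and> f \<in> Arr (Acat F)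
    \<and> Dom (Acat F) f = fst s \<and> Cod (Acat F) f = fst t
    \<and> f \<cdot>\<^bsub>Acat F\<^esub> snd s = snd t \<cdot>\<^bsub>Acat F\<^esub> FAr (Rad F) (FAr (Lad F) f)"
  by (auto simp: Alg_def EM_algebras_def)

lemma Arr_Coalg:
  "(s, f, t) \<in> Arr (Coalg F) \<longleftrightarrow> s \<in> Obj (Coalg F) \<and> t \<in> Obj (Coalg F) \<and> f \<in> Arr (Bcat F)
    \<and> Dom (Bcat F) f = fst s \<and> Cod (Bcat F) f = fst t
    \<and> FAr (Lad F) (FAr (Rad F) f) \<cdot>\<^bsub>Bcat F\<^esub> snd s = snd t \<cdot>\<^bsub>Bcat F\<^esub> f"
  by (auto simp: Coalg_def EM_coalgebras_def)

lemma Obj_AlgD [simp]: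
  assumes "s \<in> Obj (Alg F)"
  shows "fst s \<in> Obj (Acat F)" "snd s \<in> Arr (Acat F)"
    "Dom (Acat F) (snd s) = FOb (Rad F) (FOb (Lad F) (fst s))" "Cod (Acat F) (snd s) = fst s"
    "snd s \<cdot>\<^bsub>Acat F\<^esub> Unit F (fst s) = Ide (Acat F) (fst s)"
  using assms by (cases s; simp add: Obj_Alg)+

lemma Obj_CoalgD [simp]:
  assumes "s \<in> Obj (Coalg F)"
  shows "fst s \<in> Obj (Bcat F)" "snd s \<in> Arr (Bcat F)"
    "Dom (Bcat F) (snd s) = fst s" "Cod (Bcat F) (snd s) = FOb (Lad F) (FOb (Rad F) (fst s))"
    "Counit F (fst s) \<cdot>\<^bsub>Bcat F\<^esub> snd s = Ide (Bcat F) (fst s)"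
  using assms by (cases s; simp add: Obj_Coalg)+

lemma Alg_mult:
  "s \<in> Obj (Alg F) \<Longrightarrow> snd s \<cdot>\<^bsub>Acat F\<^esub> FAr (Rad F) (FAr (Lad F) (snd s))
      = snd s \<cdot>\<^bsub>Acat F\<^esub> FAr (Rad F) (Counit F (FOb (Lad F) (fst s)))"
  by (cases s) (simp add: Obj_Alg)

lemma Coalg_comult:
  "s \<in> Obj (Coalg F) \<Longrightarrow> FAr (Lad F) (FAr (Rad F) (snd s)) \<cdot>\<^bsub>Bcat F\<^esub> snd s
      = FAr (Lad F) (Unit F (FOb (Rad F) (fst s))) \<cdot>\<^bsub>Bcat F\<^esub> snd s"
  by (cases s) (simp add: Obj_Coalg)

sublocale Alg: category "Alg F"
  unfolding Alg_def by (rule category_EM_algebras) (rule cat_functor_comp[OF Lad_functor Rad_functor])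

sublocale Coalg: category "Coalg F"
  unfolding Coalg_def by (rule category_EM_coalgebras) (rule cat_functor_comp[OF Rad_functor Lad_functor])

lemma iso_arrow_Alg:
  "(s, f, t) \<in> Arr (Alg F) \<Longrightarrow> iso_arrow (Acat F) f \<Longrightarrow> iso_arrow (Alg F) (s, f, t)"
  unfolding Alg_def
  by (rule iso_arrow_EM_algebras) (rule cat_functor_comp[OF Lad_functor Rad_functor])

lemma iso_arrow_Coalg:
  "(s, f, t) \<in> Arr (Coalg F) \<Longrightarrow> iso_arrow (Bcat F) f \<Longrightarrow> iso_arrow (Coalg F) (s, f, t)"
  unfolding Coalg_def
  by (rule iso_arrow_EM_coalgebras) (rule cat_functor_comp[OF Rad_functor Lad_functor])

section \<open>Comparison functors and the two functors of the nucleus\<close>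

lemma kappa0_ob_Coalg:
  assumes "a \<in> Obj (Acat F)"
  shows "kappa0_ob F a \<in> Obj (Coalg F)"
  \<comment> \<open>Coassociativity is the image under \<open>F\<^sup>*\<close> of naturality of
    \<eta> at its own component; the counit law is the triangle identity for
    \<open>F\<^sup>*\<close>.\<close>
  using assms arg_cong[OF Unit_naturality[of "Unit F a"], of "FAr (Lad F)"]
  by (simp add: kappa0_ob_def Obj_Coalg)

lemma kappa1_ob_Alg:
  assumes "b \<in> Obj (Bcat F)"
  shows "kappa1_ob F b \<in> Obj (Alg F)"
  using assms arg_cong[OF Counit_naturality[of "Counit F b"], of "FAr (Rad F)"]
  by (simp add: kappa1_ob_def Obj_Alg)

lemma kappa0_functor: "cat_functor (Acat F) (Coalg F) (kappa0 F)"
proof (rule cat_functorI)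
  fix f assume f: "f \<in> Arr (Acat F)"
  show "FAr (kappa0 F) f \<in> Arr (Coalg F)
    \<and> Dom (Coalg F) (FAr (kappa0 F) f) = FOb (kappa0 F) (Dom (Acat F) f)
    \<and> Cod (Coalg F) (FAr (kappa0 F) f) = FOb (kappa0 F) (Cod (Acat F) f)"
    \<comment> \<open>The image under \<open>F\<^sup>*\<close> of the naturality square of \<eta> at
      \<open>f\<close> is the homomorphism condition for \<open>F\<^sup>*f\<close>.\<close>
    using f arg_cong[OF Unit_naturality[OF f], of "FAr (Lad F)"]
    by (simp add: kappa0_def Arr_Coalg kappa0_ob_Coalg) (simp add: kappa0_ob_def)
qed (auto simp: L.src.category_axioms Coalg.category_axioms kappa0_def kappa0_ob_Coalg,
    auto simp: kappa0_ob_def)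

lemma kappa1_functor: "cat_functor (Bcat F) (Alg F) (kappa1 F)"
proof (rule cat_functorI)
  fix f assume f: "f \<in> Arr (Bcat F)"
  show "FAr (kappa1 F) f \<in> Arr (Alg F)
    \<and> Dom (Alg F) (FAr (kappa1 F) f) = FOb (kappa1 F) (Dom (Bcat F) f)
    \<and> Cod (Alg F) (FAr (kappa1 F) f) = FOb (kappa1 F) (Cod (Bcat F) f)"
    using f arg_cong[OF Counit_naturality[OF f], of "FAr (Rad F)"]
    by (simp add: kappa1_def Arr_Alg kappa1_ob_Alg) (simp add: kappa1_ob_def)
qed (auto simp: L.tgt.category_axioms Alg.category_axioms kappa1_def kappa1_ob_Alg,
    auto simp: kappa1_ob_def)

lemma forget_Alg_functor: "cat_functor (Alg F) (Acat F) (forget (Alg F))"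
  using Alg.category_axioms Obj_AlgD(1)
  unfolding Alg_def EM_algebras_def
  by (intro cat_functor_forget L.src.category_axioms) auto

lemma forget_Coalg_functor: "cat_functor (Coalg F) (Bcat F) (forget (Coalg F))"
  using Coalg.category_axioms Obj_CoalgD(1)
  unfolding Coalg_def EM_coalgebras_def
  by (intro cat_functor_forget L.tgt.category_axioms) auto

lemma lower_sharp_functor: "cat_functor (Alg F) (Coalg F) (lower_sharp F)"
  unfolding lower_sharp_def by (rule cat_functor_comp[OF forget_Alg_functor kappa0_functor])

lemma upper_sharp_functor: "cat_functor (Coalg F) (Alg F) (upper_sharp F)"
  unfolding upper_sharp_def by (rule cat_functor_comp[OF forget_Coalg_functor kappa1_functor])

lemma lower_sharp_apply [simp]:
  "s \<in> Obj (Alg F) \<Longrightarrow> FOb (lower_sharp F) s = kappa0_ob F (fst s)"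
  "(s, f, t) \<in> Arr (Alg F) \<Longrightarrow>
    FAr (lower_sharp F) (s, f, t) = (kappa0_ob F (fst s), FAr (Lad F) f, kappa0_ob F (fst t))"
  by (simp_all add: lower_sharp_def kappa0_def forget_def Arr_Alg)

lemma upper_sharp_apply [simp]:
  "s \<in> Obj (Coalg F) \<Longrightarrow> FOb (upper_sharp F) s = kappa1_ob F (fst s)"
  "(s, f, t) \<in> Arr (Coalg F) \<Longrightarrow>
    FAr (upper_sharp F) (s, f, t) = (kappa1_ob F (fst s), FAr (Rad F) f, kappa1_ob F (fst t))"
  by (simp_all add: upper_sharp_def kappa1_def forget_def Arr_Coalg)

text \<open>Coassociativity, read as a homomorphism condition: a structure arrow is a morphism from
  its coalgebra to the cofree one. This arrow turns out to be the unit of the nucleus.\<close>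

lemma Coalg_structure_arrow:
  "s \<in> Obj (Coalg F) \<Longrightarrow> (s, snd s, kappa0_ob F (FOb (Rad F) (fst s))) \<in> Arr (Coalg F)"
  by (simp add: Arr_Coalg kappa0_ob_Coalg Coalg_comult) (simp add: kappa0_ob_def)

text \<open>Dually, associativity makes a structure arrow a morphism from the free algebra. This
  arrow turns out to be the counit of the nucleus.\<close>

lemma Alg_structure_arrow:
  "s \<in> Obj (Alg F) \<Longrightarrow> (kappa1_ob F (FOb (Lad F) (fst s)), snd s, s) \<in> Arr (Alg F)"
  by (simp add: Arr_Alg kappa1_ob_Alg Alg_mult) (simp add: kappa1_ob_def Alg_mult)

section \<open>Transposition between algebra and coalgebra morphisms\<close>

lemma bij_betw_nuc_transpose:
  assumes s: "s \<in> Obj (Coalg F)" and t: "t \<in> Obj (Alg F)"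
  shows "bij_betw (nuc_transpose F s t)
    (Hom (Alg F) (FOb (upper_sharp F) s) t) (Hom (Coalg F) s (FOb (lower_sharp F) t))"
proof -
  let ?U = "FOb (upper_sharp F) s" and ?V = "FOb (lower_sharp F) t"
  let ?inv = "\<lambda>(_, g, _). (?U, snd t \<cdot>\<^bsub>Acat F\<^esub> FAr (Rad F) g, t)"
  have U: "?U = (FOb (Rad F) (fst s), FAr (Rad F) (Counit F (fst s)))"
    and V: "?V = (FOb (Lad F) (fst t), FAr (Lad F) (Unit F (fst t)))"
    using s t by (simp_all add: kappa0_ob_def kappa1_ob_def)
  have UV: "?U \<in> Obj (Alg F)" "?V \<in> Obj (Coalg F)"
    using s t by (simp_all add: kappa0_ob_Coalg kappa1_ob_Alg)
  have fwd: "nuc_transpose F s t a \<in> Hom (Coalg F) s ?V \<and> ?inv (nuc_transpose F s t a) = a"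
    if a: "a \<in> Hom (Alg F) ?U t" for a
  proof -
    obtain f where af: "a = (?U, f, t)"
      using a by (cases a) (auto simp: mem_Hom)
    have f: "f \<in> Arr (Acat F)" "Dom (Acat F) f = FOb (Rad F) (fst s)" "Cod (Acat F) f = fst t"
      and hom: "snd t \<cdot>\<^bsub>Acat F\<^esub> FAr (Rad F) (FAr (Lad F) f)
        = f \<cdot>\<^bsub>Acat F\<^esub> FAr (Rad F) (Counit F (fst s))"
      using a by (auto simp: af mem_Hom Arr_Alg U)
    have 1: "FAr (Lad F) (FAr (Rad F) (FAr (Lad F) f)) \<cdot>\<^bsub>Bcat F\<^esub> FAr (Lad F) (Unit F (FOb (Rad F) (fst s)))
        = FAr (Lad F) (Unit F (fst t)) \<cdot>\<^bsub>Bcat F\<^esub> FAr (Lad F) f"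
      using arg_cong[OF Unit_naturality[OF f(1)], of "FAr (Lad F)"] f s t by simp
    have 2: "FAr (Rad F) (Counit F (fst s)) \<cdot>\<^bsub>Acat F\<^esub> FAr (Rad F) (snd s) = Ide (Acat F) (FOb (Rad F) (fst s))"
      using s by (simp flip: R.FAr_Comp_arrow)
    \<comment> \<open>Coassociativity of \<beta> produces \<open>F\<^sup>*\<close> of a unit
      component, which the square \<open>1\<close> moves past \<open>F\<^sup>*f\<close>.\<close>
    have "(s, FAr (Lad F) f \<cdot>\<^bsub>Bcat F\<^esub> snd s, ?V) \<in> Arr (Coalg F)"
      using s t f UV by (simp add: Arr_Coalg V Coalg_comult L.tgt.Comp_extend[OF 1])
    \<comment> \<open>Since \<open>f\<close> is a homomorphism out of
      \<open>F\<^sup>\<sharp>\<beta>\<close>, the left side is \<open>f\<close> followed backwards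
      by \<open>F\<^sub>*\<close> of the counit and of \<beta>, and these two cancel by the counit
      law of \<beta>.\<close>
    moreover have "snd t \<cdot>\<^bsub>Acat F\<^esub> FAr (Rad F) (FAr (Lad F) f \<cdot>\<^bsub>Bcat F\<^esub> snd s) = f"
      using s t f by (simp add: L.src.Comp_extend[OF hom] 2)
    ultimately show ?thesis
      by (simp add: nuc_transpose_def af mem_Hom)
  qed
  have bwd: "?inv a \<in> Hom (Alg F) ?U t \<and> nuc_transpose F s t (?inv a) = a"
    if a: "a \<in> Hom (Coalg F) s ?V" for a
  proof -
    obtain g where ag: "a = (s, g, ?V)"
      using a by (cases a) (auto simp: mem_Hom)
    have g: "g \<in> Arr (Bcat F)" "Dom (Bcat F) g = fst s" "Cod (Bcat F) g = FOb (Lad F) (fst t)"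
      and hom: "FAr (Lad F) (FAr (Rad F) g) \<cdot>\<^bsub>Bcat F\<^esub> snd s
        = FAr (Lad F) (Unit F (fst t)) \<cdot>\<^bsub>Bcat F\<^esub> g"
      using a by (auto simp: ag mem_Hom Arr_Coalg V)
    have 1: "FAr (Rad F) (Counit F (FOb (Lad F) (fst t))) \<cdot>\<^bsub>Acat F\<^esub> FAr (Rad F) (FAr (Lad F) (FAr (Rad F) g))
        = FAr (Rad F) g \<cdot>\<^bsub>Acat F\<^esub> FAr (Rad F) (Counit F (fst s))"
      using arg_cong[OF Counit_naturality[OF g(1)], of "FAr (Rad F)"] g s t by simp
    have 2: "FAr (Lad F) (snd t) \<cdot>\<^bsub>Bcat F\<^esub> FAr (Lad F) (Unit F (fst t)) = Ide (Bcat F) (FOb (Lad F) (fst t))"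
      using t by (simp flip: L.FAr_Comp_arrow)
    \<comment> \<open>Associativity of \<alpha> produces \<open>F\<^sub>*\<close> of a counit
      component, which the square \<open>1\<close> moves past \<open>F\<^sub>*g\<close>.\<close>
    have "(?U, snd t \<cdot>\<^bsub>Acat F\<^esub> FAr (Rad F) g, t) \<in> Arr (Alg F)"
      using s t g UV by (simp add: Arr_Alg U L.src.Comp_extend[OF Alg_mult] 1)
    moreover have "FAr (Lad F) (snd t \<cdot>\<^bsub>Acat F\<^esub> FAr (Rad F) g) \<cdot>\<^bsub>Bcat F\<^esub> snd s = g"
      using s t g by (simp add: hom L.tgt.Comp_extend[OF 2])
    ultimately show ?thesis
      by (simp add: nuc_transpose_def ag mem_Hom)
  qed
  show ?thesis
    by (rule bij_betwI[where g = ?inv]) (use fwd bwd in blast)+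
qed

lemma nuc_unit_apply [simp]:
  "s \<in> Obj (Coalg F) \<Longrightarrow> nuc_unit F s = (s, snd s, kappa0_ob F (FOb (Rad F) (fst s)))"
  by (simp add: nuc_unit_def nuc_transpose_def kappa1_ob_Alg) (simp add: kappa1_ob_def)

text \<open>The transpose of \<alpha> is \<open>F\<^sup>*(\<alpha> \<circ> \<eta>)\<close>, an
  identity by the unit law. As transposition is injective on the hom-set, \<alpha> is the preimage
  that \<open>inv_into\<close> selects.\<close>

lemma nuc_counit_apply [simp]:
  assumes s: "s \<in> Obj (Alg F)"
  shows "nuc_counit F s = (kappa1_ob F (FOb (Lad F) (fst s)), snd s, s)"
proof -
  let ?V = "FOb (lower_sharp F) s"
  have V: "?V \<in> Obj (Coalg F)"
    using s by (simp add: kappa0_ob_Coalg)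
  have "fst ?V = FOb (Lad F) (fst s)"
    using s by (simp add: kappa0_ob_def)
  then have U: "FOb (upper_sharp F) ?V = kappa1_ob F (FOb (Lad F) (fst s))"
    using V by simp
  have "FAr (Lad F) (snd s) \<cdot>\<^bsub>Bcat F\<^esub> FAr (Lad F) (Unit F (fst s)) = Ide (Bcat F) (FOb (Lad F) (fst s))"
    using s by (simp flip: L.FAr_Comp_arrow)
  then have "nuc_transpose F ?V s (kappa1_ob F (FOb (Lad F) (fst s)), snd s, s) = Ide (Coalg F) ?V"
    using s by (simp add: nuc_transpose_def) (simp add: kappa0_ob_def)
  moreover have "(kappa1_ob F (FOb (Lad F) (fst s)), snd s, s) \<in> Hom (Alg F) (FOb (upper_sharp F) ?V) s"
    unfolding U using Alg_structure_arrow[OF s] by (simp add: mem_Hom)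
  moreover have "inj_on (nuc_transpose F ?V s) (Hom (Alg F) (FOb (upper_sharp F) ?V) s)"
    using bij_betw_nuc_transpose[OF V s] by (simp add: bij_betw_def)
  ultimately have "inv_into (Hom (Alg F) (FOb (upper_sharp F) ?V) s) (nuc_transpose F ?V s)
      (Ide (Coalg F) ?V) = (kappa1_ob F (FOb (Lad F) (fst s)), snd s, s)"
    by (metis inv_into_f_f)
  with s show ?thesis
    unfolding nuc_counit_def by simp
qed

lemma Nuc_simps [simp]:
  "Acat (Nuc F) = Coalg F" "Bcat (Nuc F) = Alg F" "Lad (Nuc F) = upper_sharp F"
  "Rad (Nuc F) = lower_sharp F" "Unit (Nuc F) = nuc_unit F" "Counit (Nuc F) = nuc_counit F"
  by (simp_all add: Nuc_def)

lemma kappa_ob_sel [simp]: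
  "fst (kappa0_ob F a) = FOb (Lad F) a" "snd (kappa0_ob F a) = FAr (Lad F) (Unit F a)"
  "fst (kappa1_ob F b) = FOb (Rad F) b" "snd (kappa1_ob F b) = FAr (Rad F) (Counit F b)"
  by (simp_all add: kappa0_ob_def kappa1_ob_def)

text \<open>With structure arrows as unit and counit, their naturality is the homomorphism condition
  of the morphism at hand. The triangle identities are \<open>F\<^sub>*\<close> of the counit law of
  a coalgebra and \<open>F\<^sup>*\<close> of the unit law of an algebra.\<close>

lemma adjunction_Nuc: "adjunction (Nuc F)"
proof -
  interpret lower: cat_functor "Alg F" "Coalg F" "lower_sharp F" by (rule lower_sharp_functor)
  interpret upper: cat_functor "Coalg F" "Alg F" "upper_sharp F" by (rule upper_sharp_functor)
  show ?thesis
  proof (rule adjunction.intro; (unfold Nuc_simps)?)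
    show "nat_transformation (Coalg F) (Coalg F) (id_functor (Coalg F))
        (comp_functor (Coalg F) (lower_sharp F) (upper_sharp F)) (nuc_unit F)"
    proof (rule nat_transformationI)
      fix a assume a: "a \<in> Arr (Coalg F)"
      obtain s f t where aeq: "a = (s, f, t)" by (cases a)
      have "FAr (upper_sharp F) a \<in> Arr (Alg F)" using a by simp
      then show "FAr (comp_functor (Coalg F) (lower_sharp F) (upper_sharp F)) a \<cdot>\<^bsub>Coalg F\<^esub> nuc_unit F (Dom (Coalg F) a)
          = nuc_unit F (Cod (Coalg F) a) \<cdot>\<^bsub>Coalg F\<^esub> FAr (id_functor (Coalg F)) a"
        using a by (simp add: aeq) (simp add: Arr_Coalg)
    qed (auto simp: cat_functor_id Coalg.category_axioms Coalg_structure_arrow kappa1_ob_Alg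
        cat_functor_comp[OF upper_sharp_functor lower_sharp_functor], auto simp: nuc_unit_def)
    show "nat_transformation (Alg F) (Alg F) (comp_functor (Alg F) (upper_sharp F) (lower_sharp F))
        (id_functor (Alg F)) (nuc_counit F)"
    proof (rule nat_transformationI)
      fix a assume a: "a \<in> Arr (Alg F)"
      obtain s f t where aeq: "a = (s, f, t)" by (cases a)
      have "FAr (lower_sharp F) a \<in> Arr (Coalg F)" using a by simp
      then show "FAr (id_functor (Alg F)) a \<cdot>\<^bsub>Alg F\<^esub> nuc_counit F (Dom (Alg F) a)
          = nuc_counit F (Cod (Alg F) a) \<cdot>\<^bsub>Alg F\<^esub> FAr (comp_functor (Alg F) (upper_sharp F) (lower_sharp F)) a"
        using a by (simp add: aeq) (simp add: Arr_Alg)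
    qed (auto simp: cat_functor_id Alg.category_axioms Alg_structure_arrow kappa0_ob_Coalg
        cat_functor_comp[OF lower_sharp_functor upper_sharp_functor], auto simp: nuc_counit_def)
  next
    fix s assume s: "s \<in> Obj (Coalg F)"
    have "FAr (Rad F) (Counit F (fst s)) \<cdot>\<^bsub>Acat F\<^esub> FAr (Rad F) (snd s) = Ide (Acat F) (FOb (Rad F) (fst s))"
      using s by (simp flip: R.FAr_Comp_arrow)
    then show "nuc_counit F (FOb (upper_sharp F) s) \<cdot>\<^bsub>Alg F\<^esub> FAr (upper_sharp F) (nuc_unit F s)
        = Ide (Alg F) (FOb (upper_sharp F) s)"
      using s by (simp add: Coalg_structure_arrow kappa1_ob_Alg)
  next
    fix s assume s: "s \<in> Obj (Alg F)"
    have "FAr (Lad F) (snd s) \<cdot>\<^bsub>Bcat F\<^esub> FAr (Lad F) (Unit F (fst s)) = Ide (Bcat F) (FOb (Lad F) (fst s))"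
      using s by (simp flip: L.FAr_Comp_arrow)
    then show "FAr (lower_sharp F) (nuc_counit F s) \<cdot>\<^bsub>Coalg F\<^esub> nuc_unit F (FOb (lower_sharp F) s)
        = Ide (Coalg F) (FOb (lower_sharp F) s)"
      using s by (simp add: Alg_structure_arrow kappa0_ob_Coalg)
  qed (rule lower_sharp_functor upper_sharp_functor)+
qed

end

section \<open>The nucleus of a morphism of adjunctions\<close>

lemma Nuc_mor_simps [simp]:
  "MH (Nuc_mor F G Y) = K_ups F G Y" "MK (Nuc_mor F G Y) = H_ups F G Y"
  "upL (Nuc_mor F G Y) = ups_upper_sharp F G Y" "upR (Nuc_mor F G Y) = ups_lower_sharp F G Y"
  by (simp_all add: Nuc_mor_def)

context adj_morphism
begin

sublocale H: cat_functor "Acat F" "Acat G" "MH Y"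
  by (rule MH_functor)

sublocale K: cat_functor "Bcat F" "Bcat G" "MK Y"
  by (rule MK_functor)

section \<open>Components of \<upsilon> and the induced isomorphisms of monads and comonads\<close>

lemma upL_arrow [simp]:
  assumes "a \<in> Obj (Acat F)"
  shows "upL Y a \<in> Arr (Bcat G)" "Dom (Bcat G) (upL Y a) = FOb (MK Y) (FOb (Lad F) a)"
    "Cod (Bcat G) (upL Y a) = FOb (Lad G) (FOb (MH Y) a)" "iso_arrow (Bcat G) (upL Y a)"
  using nat_transformation.component_arrow[OF nat_isomorphism.axioms(1)[OF upL_iso] assms]
    nat_isomorphism.component_iso[OF upL_iso assms] assms by simp_all

lemma upR_arrow [simp]:
  assumes "b \<in> Obj (Bcat F)"
  shows "upR Y b \<in> Arr (Acat G)" "Dom (Acat G) (upR Y b) = FOb (MH Y) (FOb (Rad F) b)"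
    "Cod (Acat G) (upR Y b) = FOb (Rad G) (FOb (MK Y) b)" "iso_arrow (Acat G) (upR Y b)"
  using nat_transformation.component_arrow[OF nat_isomorphism.axioms(1)[OF upR_iso] assms]
    nat_isomorphism.component_iso[OF upR_iso assms] assms by simp_all

lemma upL_naturality:
  "f \<in> Arr (Acat F) \<Longrightarrow> upL Y (Cod (Acat F) f) \<cdot>\<^bsub>Bcat G\<^esub> FAr (MK Y) (FAr (Lad F) f)
    = FAr (Lad G) (FAr (MH Y) f) \<cdot>\<^bsub>Bcat G\<^esub> upL Y (Dom (Acat F) f)"
  using nat_transformation.naturality_arrow[OF nat_isomorphism.axioms(1)[OF upL_iso]] by simp

lemma upR_naturality:
  "g \<in> Arr (Bcat F) \<Longrightarrow> upR Y (Cod (Bcat F) g) \<cdot>\<^bsub>Acat G\<^esub> FAr (MH Y) (FAr (Rad F) g)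
    = FAr (Rad G) (FAr (MK Y) g) \<cdot>\<^bsub>Acat G\<^esub> upR Y (Dom (Bcat F) g)"
  using nat_transformation.naturality_arrow[OF nat_isomorphism.axioms(1)[OF upR_iso]] by simp

text \<open>A morphism of adjunctions induces an isomorphism \<open>HF\<^sub>*F\<^sup>* \<cong> G\<^sub>*G\<^sup>*H\<close> of monads along \<open>H\<close> and an
  isomorphism \<open>KF\<^sup>*F\<^sub>* \<cong> G\<^sup>*G\<^sub>*K\<close> of comonads along \<open>K\<close>.\<close>

definition monad_iso :: "'oa \<Rightarrow> 'mc" where
  "monad_iso a = FAr (Rad G) (upL Y a) \<cdot>\<^bsub>Acat G\<^esub> upR Y (FOb (Lad F) a)"

definition comonad_iso :: "'ob \<Rightarrow> 'md" where
  "comonad_iso b = FAr (Lad G) (upR Y b) \<cdot>\<^bsub>Bcat G\<^esub> upL Y (FOb (Rad F) b)"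

lemma monad_iso_arrow [simp]:
  assumes "a \<in> Obj (Acat F)"
  shows "monad_iso a \<in> Arr (Acat G)"
    "Dom (Acat G) (monad_iso a) = FOb (MH Y) (FOb (Rad F) (FOb (Lad F) a))"
    "Cod (Acat G) (monad_iso a) = FOb (Rad G) (FOb (Lad G) (FOb (MH Y) a))"
    "iso_arrow (Acat G) (monad_iso a)"
  using assms by (simp_all add: monad_iso_def)

lemma comonad_iso_arrow [simp]:
  assumes "b \<in> Obj (Bcat F)"
  shows "comonad_iso b \<in> Arr (Bcat G)"
    "Dom (Bcat G) (comonad_iso b) = FOb (MK Y) (FOb (Lad F) (FOb (Rad F) b))"
    "Cod (Bcat G) (comonad_iso b) = FOb (Lad G) (FOb (Rad G) (FOb (MK Y) b))"
  using assms by (simp_all add: comonad_iso_def)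

text \<open>Two squares are pasted along \<open>G\<^sub>*KF\<^sup>*f\<close>: naturality of
  \<open>\<upsilon>\<^sub>*\<close> at \<open>F\<^sup>*f\<close>, and \<open>G\<^sub>*\<close> of
  naturality of \<open>\<upsilon>\<^sup>*\<close> at \<open>f\<close>. The shared side is the
  instance given to \<open>Comp_extend\<close>.\<close>

lemma monad_iso_naturality:
  assumes f: "f \<in> Arr (Acat F)"
  shows "monad_iso (Cod (Acat F) f) \<cdot>\<^bsub>Acat G\<^esub> FAr (MH Y) (FAr (Rad F) (FAr (Lad F) f))
    = FAr (Rad G) (FAr (Lad G) (FAr (MH Y) f)) \<cdot>\<^bsub>Acat G\<^esub> monad_iso (Dom (Acat F) f)"
  using f upR_naturality[of "FAr (Lad F) f"] arg_cong[OF upL_naturality[OF f], of "FAr (Rad G)"]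
  by (simp add: monad_iso_def G.L.src.Comp_extend[where g = "FAr (Rad G) (FAr (MK Y) (FAr (Lad F) f))"])

lemma comonad_iso_naturality:
  assumes g: "g \<in> Arr (Bcat F)"
  shows "comonad_iso (Cod (Bcat F) g) \<cdot>\<^bsub>Bcat G\<^esub> FAr (MK Y) (FAr (Lad F) (FAr (Rad F) g))
    = FAr (Lad G) (FAr (Rad G) (FAr (MK Y) g)) \<cdot>\<^bsub>Bcat G\<^esub> comonad_iso (Dom (Bcat F) g)"
  using g upL_naturality[of "FAr (Rad F) g"] arg_cong[OF upR_naturality[OF g], of "FAr (Lad G)"]
  by (simp add: comonad_iso_def G.L.tgt.Comp_extend[where g = "FAr (Lad G) (FAr (MH Y) (FAr (Rad F) g))"])

text \<open>The defining conditions of a morphism of adjunctions directly give compatibility with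
  the units of the monads and, in the next lemma, with the counits of the comonads. Multiplication
  and comultiplication take more work.\<close>

lemma monad_iso_Unit:
  assumes "a \<in> Obj (Acat F)"
  shows "monad_iso a \<cdot>\<^bsub>Acat G\<^esub> FAr (MH Y) (Unit F a) = Unit G (FOb (MH Y) a)"
  using assms Unit_compat[OF assms] by (simp add: monad_iso_def)

lemma comonad_iso_Counit:
  assumes "b \<in> Obj (Bcat F)"
  shows "Counit G (FOb (MK Y) b) \<cdot>\<^bsub>Bcat G\<^esub> comonad_iso b = FAr (MK Y) (Counit F b)"
  using assms Counit_compat[OF assms] by (simp add: comonad_iso_def)

text \<open>Naturality of \<open>\<upsilon>\<^sub>*\<close> at the counit of \<open>F\<close>, with
  \<open>K\<epsilon>\<close> then replaced by means of the counit condition. Up to inverting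
  \<open>monad_iso\<close>, this says that \<open>\<upsilon>\<^sub>*\<close> is an algebra morphism
  from \<open>H\<^sup>\<upsilon>\<kappa>\<^sub>1b\<close> to
  \<open>\<kappa>\<^sub>1Kb\<close>.\<close>

lemma upR_Counit:
  assumes b: "b \<in> Obj (Bcat F)"
  shows "upR Y b \<cdot>\<^bsub>Acat G\<^esub> FAr (MH Y) (FAr (Rad F) (Counit F b))
    = FAr (Rad G) (Counit G (FOb (MK Y) b)) \<cdot>\<^bsub>Acat G\<^esub> FAr (Rad G) (FAr (Lad G) (upR Y b))
        \<cdot>\<^bsub>Acat G\<^esub> monad_iso (FOb (Rad F) b)"
proof -
  have "FAr (Rad G) (FAr (MK Y) (Counit F b)) \<cdot>\<^bsub>Acat G\<^esub> upR Y (FOb (Lad F) (FOb (Rad F) b))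
      = FAr (Rad G) (Counit G (FOb (MK Y) b)) \<cdot>\<^bsub>Acat G\<^esub> FAr (Rad G) (FAr (Lad G) (upR Y b))
        \<cdot>\<^bsub>Acat G\<^esub> monad_iso (FOb (Rad F) b)"
    using b by (simp add: monad_iso_def flip: Counit_compat)
  then show ?thesis
    using b upR_naturality[of "Counit F b"] by simp
qed

text \<open>Dually, the unit condition replaces the unit of \<open>G\<close>, and naturality of
  \<open>\<upsilon>\<^sup>*\<close> at the unit of \<open>F\<close> does the rest. It says that
  \<open>\<upsilon>\<^sup>*\<close> is a coalgebra morphism from
  \<open>K\<^sup>\<upsilon>\<kappa>\<^sup>0a\<close> to \<open>\<kappa>\<^sup>0Ha\<close>.\<close>

lemma upL_Unit:
  assumes a: "a \<in> Obj (Acat F)"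
  shows "FAr (Lad G) (Unit G (FOb (MH Y) a)) \<cdot>\<^bsub>Bcat G\<^esub> upL Y a
    = FAr (Lad G) (FAr (Rad G) (upL Y a)) \<cdot>\<^bsub>Bcat G\<^esub> comonad_iso (FOb (Lad F) a)
        \<cdot>\<^bsub>Bcat G\<^esub> FAr (MK Y) (FAr (Lad F) (Unit F a))"
proof -
  have "FAr (Lad G) (Unit G (FOb (MH Y) a)) \<cdot>\<^bsub>Bcat G\<^esub> upL Y a
      = FAr (Lad G) (FAr (Rad G) (upL Y a)) \<cdot>\<^bsub>Bcat G\<^esub> FAr (Lad G) (upR Y (FOb (Lad F) a))
        \<cdot>\<^bsub>Bcat G\<^esub> FAr (Lad G) (FAr (MH Y) (Unit F a)) \<cdot>\<^bsub>Bcat G\<^esub> upL Y a"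
    using a by (simp flip: Unit_compat)
  also have "FAr (Lad G) (FAr (MH Y) (Unit F a)) \<cdot>\<^bsub>Bcat G\<^esub> upL Y a
      = upL Y (FOb (Rad F) (FOb (Lad F) a)) \<cdot>\<^bsub>Bcat G\<^esub> FAr (MK Y) (FAr (Lad F) (Unit F a))"
    using a upL_naturality[of "Unit F a"] by simp
  finally show ?thesis
    using a by (simp add: comonad_iso_def)
qed

text \<open>Take \<open>upR_Counit\<close> at \<open>F\<^sup>*a\<close> and postcompose with
  \<open>G\<^sub>*\<upsilon>\<^sup>*\<close>; naturality of the counit of \<open>G\<close> at
  \<open>\<upsilon>\<^sup>*\<close> moves this factor inside.\<close>

lemma monad_iso_mult:
  assumes a: "a \<in> Obj (Acat F)"
  shows "monad_iso a \<cdot>\<^bsub>Acat G\<^esub> FAr (MH Y) (FAr (Rad F) (Counit F (FOb (Lad F) a)))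
    = FAr (Rad G) (Counit G (FOb (Lad G) (FOb (MH Y) a)))
        \<cdot>\<^bsub>Acat G\<^esub> FAr (Rad G) (FAr (Lad G) (monad_iso a))
        \<cdot>\<^bsub>Acat G\<^esub> monad_iso (FOb (Rad F) (FOb (Lad F) a))"
proof -
  have nat: "FAr (Rad G) (upL Y a) \<cdot>\<^bsub>Acat G\<^esub> FAr (Rad G) (Counit G (FOb (MK Y) (FOb (Lad F) a)))
      = FAr (Rad G) (Counit G (FOb (Lad G) (FOb (MH Y) a)))
        \<cdot>\<^bsub>Acat G\<^esub> FAr (Rad G) (FAr (Lad G) (FAr (Rad G) (upL Y a)))"
    using a arg_cong[OF G.Counit_naturality[of "upL Y a"], of "FAr (Rad G)"] by simp
  have "monad_iso a \<cdot>\<^bsub>Acat G\<^esub> FAr (MH Y) (FAr (Rad F) (Counit F (FOb (Lad F) a)))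
      = FAr (Rad G) (upL Y a) \<cdot>\<^bsub>Acat G\<^esub> upR Y (FOb (Lad F) a)
        \<cdot>\<^bsub>Acat G\<^esub> FAr (MH Y) (FAr (Rad F) (Counit F (FOb (Lad F) a)))"
    using a by (simp add: monad_iso_def)
  also have "\<dots> = FAr (Rad G) (Counit G (FOb (Lad G) (FOb (MH Y) a)))
        \<cdot>\<^bsub>Acat G\<^esub> FAr (Rad G) (FAr (Lad G) (monad_iso a))
        \<cdot>\<^bsub>Acat G\<^esub> monad_iso (FOb (Rad F) (FOb (Lad F) a))"
    using a by (simp add: upR_Counit G.L.src.Comp_extend[OF nat]) (simp add: monad_iso_def)
  finally show ?thesis .
qed

text \<open>Naturality of the unit of \<open>G\<close> at \<open>\<upsilon>\<^sub>*\<close> reduces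
  the claim to \<open>upL_Unit\<close> at \<open>F\<^sub>*b\<close>.\<close>

lemma comonad_iso_comult:
  assumes b: "b \<in> Obj (Bcat F)"
  shows "FAr (Lad G) (Unit G (FOb (Rad G) (FOb (MK Y) b))) \<cdot>\<^bsub>Bcat G\<^esub> comonad_iso b
    = FAr (Lad G) (FAr (Rad G) (comonad_iso b)) \<cdot>\<^bsub>Bcat G\<^esub> comonad_iso (FOb (Lad F) (FOb (Rad F) b))
        \<cdot>\<^bsub>Bcat G\<^esub> FAr (MK Y) (FAr (Lad F) (Unit F (FOb (Rad F) b)))"
proof -
  have nat: "FAr (Lad G) (Unit G (FOb (Rad G) (FOb (MK Y) b))) \<cdot>\<^bsub>Bcat G\<^esub> FAr (Lad G) (upR Y b)
      = FAr (Lad G) (FAr (Rad G) (FAr (Lad G) (upR Y b)))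
        \<cdot>\<^bsub>Bcat G\<^esub> FAr (Lad G) (Unit G (FOb (MH Y) (FOb (Rad F) b)))"
    using b arg_cong[OF G.Unit_naturality[of "upR Y b"], of "FAr (Lad G)"] by simp
  have "FAr (Lad G) (Unit G (FOb (Rad G) (FOb (MK Y) b))) \<cdot>\<^bsub>Bcat G\<^esub> comonad_iso b
      = FAr (Lad G) (FAr (Rad G) (FAr (Lad G) (upR Y b)))
        \<cdot>\<^bsub>Bcat G\<^esub> FAr (Lad G) (Unit G (FOb (MH Y) (FOb (Rad F) b))) \<cdot>\<^bsub>Bcat G\<^esub> upL Y (FOb (Rad F) b)"
    using b by (simp add: comonad_iso_def G.L.tgt.Comp_extend[OF nat])
  also have "\<dots> = FAr (Lad G) (FAr (Rad G) (comonad_iso b))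
      \<cdot>\<^bsub>Bcat G\<^esub> comonad_iso (FOb (Lad F) (FOb (Rad F) b))
      \<cdot>\<^bsub>Bcat G\<^esub> FAr (MK Y) (FAr (Lad F) (Unit F (FOb (Rad F) b)))"
    using b by (simp add: upL_Unit) (simp add: comonad_iso_def)
  finally show ?thesis .
qed

section \<open>The functors \<open>K\<^sup>\<upsilon>\<close> and
  \<open>H\<^sup>\<upsilon>\<close>\<close>

lemma K_ups_ob_eq:
  "s \<in> Obj (Coalg F) \<Longrightarrow>
    K_ups_ob F G Y s = (FOb (MK Y) (fst s), comonad_iso (fst s) \<cdot>\<^bsub>Bcat G\<^esub> FAr (MK Y) (snd s))"
  by (cases s) (simp add: K_ups_ob_def comonad_iso_def F.Obj_Coalg)

text \<open>The two inverses in \<open>H_ups_ob\<close>, in this order, compose to the inverse of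
  \<open>monad_iso\<close>.\<close>

lemma H_ups_ob_eq:
  "s \<in> Obj (Alg F) \<Longrightarrow>
    H_ups_ob F G Y s = (FOb (MH Y) (fst s),
      FAr (MH Y) (snd s) \<cdot>\<^bsub>Acat G\<^esub> inv_arrow (Acat G) (monad_iso (fst s)))"
  by (cases s) (simp add: H_ups_ob_def monad_iso_def F.Obj_Alg)

text \<open>Each law is \<open>K\<close> of the corresponding law of \<open>s\<close>, carried over
  by the compatibility of \<open>comonad_iso\<close> with counit or comultiplication;
  coassociativity also needs its naturality at the structure arrow.\<close>

lemma K_ups_ob_Coalg:
  assumes s: "s \<in> Obj (Coalg F)"
  shows "K_ups_ob F G Y s \<in> Obj (Coalg G)"
proof -
  have counit: "FAr (MK Y) (Counit F (fst s)) \<cdot>\<^bsub>Bcat G\<^esub> FAr (MK Y) (snd s) = Ide (Bcat G) (FOb (MK Y) (fst s))"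
    using s by (simp flip: K.FAr_Comp_arrow)
  have comult: "FAr (MK Y) (FAr (Lad F) (Unit F (FOb (Rad F) (fst s)))) \<cdot>\<^bsub>Bcat G\<^esub> FAr (MK Y) (snd s)
      = FAr (MK Y) (FAr (Lad F) (FAr (Rad F) (snd s))) \<cdot>\<^bsub>Bcat G\<^esub> FAr (MK Y) (snd s)"
    using s arg_cong[OF F.Coalg_comult[OF s], of "FAr (MK Y)"] by simp
  have nat: "comonad_iso (FOb (Lad F) (FOb (Rad F) (fst s)))
        \<cdot>\<^bsub>Bcat G\<^esub> FAr (MK Y) (FAr (Lad F) (FAr (Rad F) (snd s)))
      = FAr (Lad G) (FAr (Rad G) (FAr (MK Y) (snd s))) \<cdot>\<^bsub>Bcat G\<^esub> comonad_iso (fst s)"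
    using s comonad_iso_naturality[of "snd s"] by simp
  show ?thesis
    using s by (simp add: K_ups_ob_eq G.Obj_Coalg counit comult
        G.L.tgt.Comp_extend[OF comonad_iso_Counit] G.L.tgt.Comp_extend[OF comonad_iso_comult]
        G.L.tgt.Comp_extend[OF nat])
qed

lemma H_ups_ob_Alg:
  assumes s: "s \<in> Obj (Alg F)"
  shows "H_ups_ob F G Y s \<in> Obj (Alg G)"
proof -
  have unit: "FAr (MH Y) (snd s) \<cdot>\<^bsub>Acat G\<^esub> FAr (MH Y) (Unit F (fst s)) = Ide (Acat G) (FOb (MH Y) (fst s))"
    using s by (simp flip: H.FAr_Comp_arrow)
  have mult: "FAr (MH Y) (snd s) \<cdot>\<^bsub>Acat G\<^esub> FAr (MH Y) (FAr (Rad F) (FAr (Lad F) (snd s)))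
      = FAr (MH Y) (snd s) \<cdot>\<^bsub>Acat G\<^esub> FAr (MH Y) (FAr (Rad F) (Counit F (FOb (Lad F) (fst s))))"
    using s arg_cong[OF F.Alg_mult[OF s], of "FAr (MH Y)"] by simp
  \<comment> \<open>The transported structure contains the inverse of \<open>monad_iso\<close>, so
    naturality and then compatibility with multiplication are first inverted.\<close>
  have nat: "inv_arrow (Acat G) (monad_iso (fst s)) \<cdot>\<^bsub>Acat G\<^esub> FAr (Rad G) (FAr (Lad G) (FAr (MH Y) (snd s)))
      = FAr (MH Y) (FAr (Rad F) (FAr (Lad F) (snd s)))
        \<cdot>\<^bsub>Acat G\<^esub> inv_arrow (Acat G) (monad_iso (FOb (Rad F) (FOb (Lad F) (fst s))))"
    by (rule G.L.src.inv_arrow_square[symmetric])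
      (use s monad_iso_naturality[of "snd s"] in simp_all)
  have inv_mult: "FAr (MH Y) (FAr (Rad F) (Counit F (FOb (Lad F) (fst s))))
        \<cdot>\<^bsub>Acat G\<^esub> inv_arrow (Acat G) (monad_iso (FOb (Rad F) (FOb (Lad F) (fst s))))
        \<cdot>\<^bsub>Acat G\<^esub> inv_arrow (Acat G) (FAr (Rad G) (FAr (Lad G) (monad_iso (fst s))))
      = inv_arrow (Acat G) (monad_iso (fst s))
        \<cdot>\<^bsub>Acat G\<^esub> FAr (Rad G) (Counit G (FOb (Lad G) (FOb (MH Y) (fst s))))"
  proof -
    have "FAr (MH Y) (FAr (Rad F) (Counit F (FOb (Lad F) (fst s))))
        \<cdot>\<^bsub>Acat G\<^esub> inv_arrow (Acat G) (FAr (Rad G) (FAr (Lad G) (monad_iso (fst s)))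
          \<cdot>\<^bsub>Acat G\<^esub> monad_iso (FOb (Rad F) (FOb (Lad F) (fst s))))
      = inv_arrow (Acat G) (monad_iso (fst s))
        \<cdot>\<^bsub>Acat G\<^esub> FAr (Rad G) (Counit G (FOb (Lad G) (FOb (MH Y) (fst s))))"
      \<comment> \<open>\<open>monad_iso_mult\<close> is a square with \<open>monad_iso\<close> on
        one side and a composite of two isomorphisms on the other. The inverse of that composite is
        split afterwards.\<close>
      by (rule G.L.src.inv_arrow_square) (use s in \<open>simp_all add: monad_iso_mult\<close>)
    then show ?thesis
      using s by simp
  qed
  have unit': "inv_arrow (Acat G) (monad_iso (fst s)) \<cdot>\<^bsub>Acat G\<^esub> Unit G (FOb (MH Y) (fst s))
      = FAr (MH Y) (Unit F (fst s))"
    using s by (simp flip: monad_iso_Unit)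
  show ?thesis
    using s by (simp add: H_ups_ob_eq G.Obj_Alg unit unit' G.L.src.Comp_extend[OF nat]
        G.L.src.Comp_extend[OF mult] inv_mult)
qed

lemma K_ups_apply [simp]:
  "s \<in> Obj (Coalg F) \<Longrightarrow> FOb (K_ups F G Y) s = K_ups_ob F G Y s"
  "(s, f, t) \<in> Arr (Coalg F) \<Longrightarrow>
    FAr (K_ups F G Y) (s, f, t) = (K_ups_ob F G Y s, FAr (MK Y) f, K_ups_ob F G Y t)"
  by (simp_all add: K_ups_def)

lemma H_ups_apply [simp]:
  "s \<in> Obj (Alg F) \<Longrightarrow> FOb (H_ups F G Y) s = H_ups_ob F G Y s"
  "(s, f, t) \<in> Arr (Alg F) \<Longrightarrow>
    FAr (H_ups F G Y) (s, f, t) = (H_ups_ob F G Y s, FAr (MH Y) f, H_ups_ob F G Y t)"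
  by (simp_all add: H_ups_def)

text \<open>The homomorphism square of \<open>K f\<close> is pasted from \<open>K\<close> of that of
  \<open>f\<close> and the naturality square of \<open>comonad_iso\<close> at
  \<open>f\<close>.\<close>

lemma K_ups_functor: "cat_functor (Coalg F) (Coalg G) (K_ups F G Y)"
proof (rule cat_functorI)
  fix a assume a: "a \<in> Arr (Coalg F)"
  obtain s f t where aeq: "a = (s, f, t)" by (cases a)
  have f: "s \<in> Obj (Coalg F)" "t \<in> Obj (Coalg F)" "f \<in> Arr (Bcat F)"
      "Dom (Bcat F) f = fst s" "Cod (Bcat F) f = fst t"
    and hom: "FAr (MK Y) (FAr (Lad F) (FAr (Rad F) f)) \<cdot>\<^bsub>Bcat G\<^esub> FAr (MK Y) (snd s)
      = FAr (MK Y) (snd t) \<cdot>\<^bsub>Bcat G\<^esub> FAr (MK Y) f"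
    using a by (auto simp: aeq F.Arr_Coalg simp flip: K.FAr_Comp_arrow)
  have nat: "FAr (Lad G) (FAr (Rad G) (FAr (MK Y) f)) \<cdot>\<^bsub>Bcat G\<^esub> comonad_iso (fst s)
      = comonad_iso (fst t) \<cdot>\<^bsub>Bcat G\<^esub> FAr (MK Y) (FAr (Lad F) (FAr (Rad F) f))"
    using f comonad_iso_naturality[of f] by simp
  show "FAr (K_ups F G Y) a \<in> Arr (Coalg G)
    \<and> Dom (Coalg G) (FAr (K_ups F G Y) a) = FOb (K_ups F G Y) (Dom (Coalg F) a)
    \<and> Cod (Coalg G) (FAr (K_ups F G Y) a) = FOb (K_ups F G Y) (Cod (Coalg F) a)"
    using a f
    by (simp add: aeq G.Arr_Coalg K_ups_ob_Coalg)
      (simp add: K_ups_ob_eq hom G.L.tgt.Comp_extend[OF nat])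
next
  fix a b assume ab: "a \<in> Arr (Coalg F)" "b \<in> Arr (Coalg F)" "Dom (Coalg F) b = Cod (Coalg F) a"
  obtain s f t where aeq: "a = (s, f, t)" by (cases a)
  obtain t' g u where beq: "b = (t', g, u)" by (cases b)
  \<comment> \<open>\<open>FAr (K_ups F G Y)\<close> is undefined off \<open>Arr (Coalg F)\<close>,
    so the composite must be known to be an arrow before it can be evaluated.\<close>
  show "FAr (K_ups F G Y) (b \<cdot>\<^bsub>Coalg F\<^esub> a) = FAr (K_ups F G Y) b \<cdot>\<^bsub>Coalg G\<^esub> FAr (K_ups F G Y) a"
    using ab F.Coalg.Comp_arrow(1)[OF ab] by (simp add: aeq beq) (simp add: F.Arr_Coalg)
next
  fix s assume s: "s \<in> Obj (Coalg F)"
  show "FAr (K_ups F G Y) (Ide (Coalg F) s) = Ide (Coalg G) (FOb (K_ups F G Y) s)"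
    using s F.Coalg.Ide_arrow(1)[OF s] by (simp add: K_ups_ob_eq)
qed (auto simp: F.Coalg.category_axioms G.Coalg.category_axioms K_ups_ob_Coalg,
    auto simp: K_ups_def extensional_def)

lemma H_ups_functor: "cat_functor (Alg F) (Alg G) (H_ups F G Y)"
proof (rule cat_functorI)
  fix a assume a: "a \<in> Arr (Alg F)"
  obtain s f t where aeq: "a = (s, f, t)" by (cases a)
  have f: "s \<in> Obj (Alg F)" "t \<in> Obj (Alg F)" "f \<in> Arr (Acat F)"
      "Dom (Acat F) f = fst s" "Cod (Acat F) f = fst t"
    and hom: "FAr (MH Y) f \<cdot>\<^bsub>Acat G\<^esub> FAr (MH Y) (snd s)
      = FAr (MH Y) (snd t) \<cdot>\<^bsub>Acat G\<^esub> FAr (MH Y) (FAr (Rad F) (FAr (Lad F) f))"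
    using a by (auto simp: aeq F.Arr_Alg simp flip: H.FAr_Comp_arrow)
  have nat: "inv_arrow (Acat G) (monad_iso (fst t)) \<cdot>\<^bsub>Acat G\<^esub> FAr (Rad G) (FAr (Lad G) (FAr (MH Y) f))
      = FAr (MH Y) (FAr (Rad F) (FAr (Lad F) f)) \<cdot>\<^bsub>Acat G\<^esub> inv_arrow (Acat G) (monad_iso (fst s))"
    by (rule G.L.src.inv_arrow_square[symmetric]) (use f monad_iso_naturality[of f] in simp_all)
  show "FAr (H_ups F G Y) a \<in> Arr (Alg G)
    \<and> Dom (Alg G) (FAr (H_ups F G Y) a) = FOb (H_ups F G Y) (Dom (Alg F) a)
    \<and> Cod (Alg G) (FAr (H_ups F G Y) a) = FOb (H_ups F G Y) (Cod (Alg F) a)"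
    using a f
    by (simp add: aeq G.Arr_Alg H_ups_ob_Alg)
      (simp add: H_ups_ob_eq nat G.L.src.Comp_extend[OF hom])
next
  fix a b assume ab: "a \<in> Arr (Alg F)" "b \<in> Arr (Alg F)" "Dom (Alg F) b = Cod (Alg F) a"
  obtain s f t where aeq: "a = (s, f, t)" by (cases a)
  obtain t' g u where beq: "b = (t', g, u)" by (cases b)
  show "FAr (H_ups F G Y) (b \<cdot>\<^bsub>Alg F\<^esub> a) = FAr (H_ups F G Y) b \<cdot>\<^bsub>Alg G\<^esub> FAr (H_ups F G Y) a"
    using ab F.Alg.Comp_arrow(1)[OF ab] by (simp add: aeq beq) (simp add: F.Arr_Alg)
next
  fix s assume s: "s \<in> Obj (Alg F)"
  show "FAr (H_ups F G Y) (Ide (Alg F) s) = Ide (Alg G) (FOb (H_ups F G Y) s)"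
    using s F.Alg.Ide_arrow(1)[OF s] by (simp add: H_ups_ob_eq)
qed (auto simp: F.Alg.category_axioms G.Alg.category_axioms H_ups_ob_Alg,
    auto simp: H_ups_def extensional_def)

section \<open>The isomorphisms \<open>\<upsilon>\<^sup>\<sharp>\<close> and
  \<open>\<upsilon>\<^sub>\<sharp>\<close>\<close>

lemma fst_ups_ob [simp]:
  "s \<in> Obj (Coalg F) \<Longrightarrow> fst (K_ups_ob F G Y s) = FOb (MK Y) (fst s)"
  "t \<in> Obj (Alg F) \<Longrightarrow> fst (H_ups_ob F G Y t) = FOb (MH Y) (fst t)"
  by (simp_all add: K_ups_ob_eq H_ups_ob_eq)

lemma ups_upper_sharp_apply [simp]:
  "s \<in> Obj (Coalg F) \<Longrightarrow> ups_upper_sharp F G Y s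
    = (H_ups_ob F G Y (kappa1_ob F (fst s)), upR Y (fst s), kappa1_ob G (FOb (MK Y) (fst s)))"
  by (simp add: ups_upper_sharp_def K_ups_ob_Coalg F.kappa1_ob_Alg)

lemma ups_lower_sharp_apply [simp]:
  "s \<in> Obj (Alg F) \<Longrightarrow> ups_lower_sharp F G Y s
    = (K_ups_ob F G Y (kappa0_ob F (fst s)), upL Y (fst s), kappa0_ob G (FOb (MH Y) (fst s)))"
  by (simp add: ups_lower_sharp_def H_ups_ob_Alg F.kappa0_ob_Coalg)

text \<open>Precomposing \<open>upR_Counit\<close> with the inverse of \<open>monad_iso\<close>
  yields the homomorphism condition.\<close>

lemma upR_Alg_arrow:
  assumes b: "b \<in> Obj (Bcat F)"
  shows "(H_ups_ob F G Y (kappa1_ob F b), upR Y b, kappa1_ob G (FOb (MK Y) b)) \<in> Arr (Alg G)"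
proof -
  have "(upR Y b \<cdot>\<^bsub>Acat G\<^esub> FAr (MH Y) (FAr (Rad F) (Counit F b)))
        \<cdot>\<^bsub>Acat G\<^esub> inv_arrow (Acat G) (monad_iso (FOb (Rad F) b))
      = FAr (Rad G) (Counit G (FOb (MK Y) b)) \<cdot>\<^bsub>Acat G\<^esub> FAr (Rad G) (FAr (Lad G) (upR Y b))"
    unfolding upR_Counit[OF b] using b by simp
  with b show ?thesis
    by (simp add: G.Arr_Alg H_ups_ob_Alg F.kappa1_ob_Alg G.kappa1_ob_Alg)
      (simp add: H_ups_ob_eq F.kappa1_ob_Alg)
qed

lemma upL_Coalg_arrow:
  assumes a: "a \<in> Obj (Acat F)"
  shows "(K_ups_ob F G Y (kappa0_ob F a), upL Y a, kappa0_ob G (FOb (MH Y) a)) \<in> Arr (Coalg G)"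
  using a upL_Unit[OF a]
  by (simp add: G.Arr_Coalg K_ups_ob_Coalg F.kappa0_ob_Coalg G.kappa0_ob_Coalg)
    (simp add: K_ups_ob_eq F.kappa0_ob_Coalg)

text \<open>Naturality is that of \<open>\<upsilon>\<^sub>*\<close> on underlying arrows;
  invertibility lifts from \<open>\<upsilon>\<^sub>*\<close> because the forgetful functor reflects
  isomorphisms.\<close>

lemma ups_upper_sharp_iso:
  "nat_isomorphism (Coalg F) (Alg G) (comp_functor (Coalg F) (H_ups F G Y) (upper_sharp F))
    (comp_functor (Coalg F) (upper_sharp G) (K_ups F G Y)) (ups_upper_sharp F G Y)"
proof (intro nat_isomorphism.intro nat_isomorphism_axioms.intro nat_transformationI)
  interpret FU: cat_functor "Coalg F" "Alg F" "upper_sharp F" by (rule F.upper_sharp_functor)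
  interpret K': cat_functor "Coalg F" "Coalg G" "K_ups F G Y" by (rule K_ups_functor)
  fix a assume a: "a \<in> Arr (Coalg F)"
  obtain s f t where aeq: "a = (s, f, t)" by (cases a)
  have "FAr (upper_sharp F) a \<in> Arr (Alg F)" "FAr (K_ups F G Y) a \<in> Arr (Coalg G)"
    using a by simp_all
  then show "FAr (comp_functor (Coalg F) (upper_sharp G) (K_ups F G Y)) a \<cdot>\<^bsub>Alg G\<^esub> ups_upper_sharp F G Y (Dom (Coalg F) a)
      = ups_upper_sharp F G Y (Cod (Coalg F) a) \<cdot>\<^bsub>Alg G\<^esub> FAr (comp_functor (Coalg F) (H_ups F G Y) (upper_sharp F)) a"
    using a upR_naturality[of f] by (simp add: aeq) (simp add: F.Arr_Coalg)
next
  fix s assume "s \<in> Obj (Coalg F)"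
  then show "iso_arrow (Alg G) (ups_upper_sharp F G Y s)"
    by (simp add: G.iso_arrow_Alg upR_Alg_arrow)
qed (auto simp: F.kappa1_ob_Alg K_ups_ob_Coalg upR_Alg_arrow
    cat_functor_comp[OF F.upper_sharp_functor H_ups_functor]
    cat_functor_comp[OF K_ups_functor G.upper_sharp_functor], auto simp: ups_upper_sharp_def)

lemma ups_lower_sharp_iso:
  "nat_isomorphism (Alg F) (Coalg G) (comp_functor (Alg F) (K_ups F G Y) (lower_sharp F))
    (comp_functor (Alg F) (lower_sharp G) (H_ups F G Y)) (ups_lower_sharp F G Y)"
proof (intro nat_isomorphism.intro nat_isomorphism_axioms.intro nat_transformationI)
  interpret FL: cat_functor "Alg F" "Coalg F" "lower_sharp F" by (rule F.lower_sharp_functor)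
  interpret H': cat_functor "Alg F" "Alg G" "H_ups F G Y" by (rule H_ups_functor)
  fix a assume a: "a \<in> Arr (Alg F)"
  obtain s f t where aeq: "a = (s, f, t)" by (cases a)
  have "FAr (lower_sharp F) a \<in> Arr (Coalg F)" "FAr (H_ups F G Y) a \<in> Arr (Alg G)"
    using a by simp_all
  then show "FAr (comp_functor (Alg F) (lower_sharp G) (H_ups F G Y)) a \<cdot>\<^bsub>Coalg G\<^esub> ups_lower_sharp F G Y (Dom (Alg F) a)
      = ups_lower_sharp F G Y (Cod (Alg F) a) \<cdot>\<^bsub>Coalg G\<^esub> FAr (comp_functor (Alg F) (K_ups F G Y) (lower_sharp F)) a"
    using a upL_naturality[of f] by (simp add: aeq) (simp add: F.Arr_Alg)
next
  fix s assume "s \<in> Obj (Alg F)"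
  then show "iso_arrow (Coalg G) (ups_lower_sharp F G Y s)"
    by (simp add: G.iso_arrow_Coalg upL_Coalg_arrow)
qed (auto simp: F.kappa0_ob_Coalg H_ups_ob_Alg upL_Coalg_arrow
    cat_functor_comp[OF F.lower_sharp_functor K_ups_functor]
    cat_functor_comp[OF H_ups_functor G.lower_sharp_functor], auto simp: ups_lower_sharp_def)

lemma adj_morphism_Nuc: "adj_morphism (Nuc F) (Nuc G) (Nuc_mor F G Y)"
proof (intro adj_morphism.intro adj_morphism_axioms.intro F.adjunction_Nuc G.adjunction_Nuc;
    unfold Nuc_mor_simps F.Nuc_simps G.Nuc_simps)
  fix s assume s: "s \<in> Obj (Coalg F)"
  then show "FAr (lower_sharp G) (ups_upper_sharp F G Y s)
      \<cdot>\<^bsub>Coalg G\<^esub> ups_lower_sharp F G Y (FOb (upper_sharp F) s) \<cdot>\<^bsub>Coalg G\<^esub> FAr (K_ups F G Y) (nuc_unit F s)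
    = nuc_unit G (FOb (K_ups F G Y) s)"
    by (simp add: upR_Alg_arrow F.kappa1_ob_Alg F.Coalg_structure_arrow K_ups_ob_Coalg)
      (simp add: K_ups_ob_eq comonad_iso_def)
next
  fix s assume s: "s \<in> Obj (Alg F)"
  \<comment> \<open>The two cells on the left compose to \<open>monad_iso\<close> on underlying
    arrows, which cancels its inverse inside \<open>H\<^sup>\<upsilon>\<alpha>\<close>.\<close>
  then show "nuc_counit G (FOb (H_ups F G Y) s) \<cdot>\<^bsub>Alg G\<^esub> FAr (upper_sharp G) (ups_lower_sharp F G Y s)
      \<cdot>\<^bsub>Alg G\<^esub> ups_upper_sharp F G Y (FOb (lower_sharp F) s)
    = FAr (H_ups F G Y) (nuc_counit F s)"
    by (simp add: upL_Coalg_arrow F.kappa0_ob_Coalg F.Alg_structure_arrow H_ups_ob_Alg)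
      (simp add: H_ups_ob_eq flip: monad_iso_def)
qed (rule K_ups_functor H_ups_functor ups_upper_sharp_iso ups_lower_sharp_iso)+

end

section \<open>Functoriality\<close>

lemma adj_mor_eqI:
  fixes Y Z :: "('oa, 'ma, 'ob, 'mb, 'oc, 'mc, 'od, 'md) adj_mor"
  assumes "adj_morphism F G Y" "adj_morphism F G Z" "MH Y = MH Z" "MK Y = MK Z"
    and "\<And>a. a \<in> Obj (Acat F) \<Longrightarrow> upL Y a = upL Z a" "\<And>b. b \<in> Obj (Bcat F) \<Longrightarrow> upR Y b = upR Z b"
  shows "Y = Z"
proof (rule adj_mor.equality)
  note ext = nat_transformation.components_extensional[OF nat_isomorphism.axioms(1)]
  show "upL Y = upL Z"
    using assms by (intro extensionalityI[OF ext ext]) (auto intro: adj_morphism.upL_iso)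
  show "upR Y = upR Z"
    using assms by (intro extensionalityI[OF ext ext]) (auto intro: adj_morphism.upR_iso)
qed (simp_all add: assms)

lemma nat_isomorphismI:
  assumes "nat_transformation A B S T \<tau>" "\<And>x. x \<in> Obj A \<Longrightarrow> iso_arrow B (\<tau> x)"
  shows "nat_isomorphism A B S T \<tau>"
  using assms by (simp add: nat_isomorphism_def nat_isomorphism_axioms_def)

lemma id_adj_mor_simps [simp]:
  "MH (id_adj_mor F) = id_functor (Acat F)"
  "MK (id_adj_mor F) = id_functor (Bcat F)"
  "a \<in> Obj (Acat F) \<Longrightarrow> upL (id_adj_mor F) a = Ide (Bcat F) (FOb (Lad F) a)"
  "b \<in> Obj (Bcat F) \<Longrightarrow> upR (id_adj_mor F) b = Ide (Acat F) (FOb (Rad F) b)"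
  "upL (id_adj_mor F) \<in> extensional (Obj (Acat F))"
  "upR (id_adj_mor F) \<in> extensional (Obj (Bcat F))"
  by (simp_all add: id_adj_mor_def)

lemma comp_adj_mor_simps [simp]:
  "MH (comp_adj_mor F L Z Y) = comp_functor (Acat F) (MH Z) (MH Y)"
  "MK (comp_adj_mor F L Z Y) = comp_functor (Bcat F) (MK Z) (MK Y)"
  "a \<in> Obj (Acat F) \<Longrightarrow>
    upL (comp_adj_mor F L Z Y) a = upL Z (FOb (MH Y) a) \<cdot>\<^bsub>Bcat L\<^esub> FAr (MK Z) (upL Y a)"
  "b \<in> Obj (Bcat F) \<Longrightarrow>
    upR (comp_adj_mor F L Z Y) b = upR Z (FOb (MK Y) b) \<cdot>\<^bsub>Acat L\<^esub> FAr (MH Z) (upR Y b)"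
  "upL (comp_adj_mor F L Z Y) \<in> extensional (Obj (Acat F))"
  "upR (comp_adj_mor F L Z Y) \<in> extensional (Obj (Bcat F))"
  by (simp_all add: comp_adj_mor_def)

lemma adj_morphism_id:
  assumes "adjunction F"
  shows "adj_morphism F F (id_adj_mor F)"
proof -
  interpret F: adjunction F by fact
  note id = cat_functor_id[OF F.L.src.category_axioms] cat_functor_id[OF F.L.tgt.category_axioms]
  note func = id cat_functor_comp[OF F.Lad_functor id(2)] cat_functor_comp[OF id(1) F.Lad_functor]
    cat_functor_comp[OF F.Rad_functor id(1)] cat_functor_comp[OF id(2) F.Rad_functor]
  show ?thesis
  proof (intro adj_morphism.intro adj_morphism_axioms.intro assms)
    show "nat_isomorphism (Acat F) (Bcat F) (comp_functor (Acat F) (MK (id_adj_mor F)) (Lad F))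
        (comp_functor (Acat F) (Lad F) (MH (id_adj_mor F))) (upL (id_adj_mor F))"
      by (intro nat_isomorphismI nat_transformationI) (simp_all add: func)
    show "nat_isomorphism (Bcat F) (Acat F) (comp_functor (Bcat F) (MH (id_adj_mor F)) (Rad F))
        (comp_functor (Bcat F) (Rad F) (MK (id_adj_mor F))) (upR (id_adj_mor F))"
      by (intro nat_isomorphismI nat_transformationI) (simp_all add: func)
  qed (simp_all add: func)
qed

lemma adj_morphism_comp:
  assumes "adj_morphism F G Y" "adj_morphism G L Z"
  shows "adj_morphism F L (comp_adj_mor F L Z Y)"
proof -
  interpret Y: adj_morphism F G Y by fact
  interpret Z: adj_morphism G L Z by fact
  note MH = cat_functor_comp[OF Y.MH_functor Z.MH_functor]
    and MK = cat_functor_comp[OF Y.MK_functor Z.MK_functor]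
  show ?thesis
  proof (intro adj_morphism.intro adj_morphism_axioms.intro Y.F.adjunction_axioms Z.G.adjunction_axioms)
    show "nat_isomorphism (Acat F) (Bcat L) (comp_functor (Acat F) (MK (comp_adj_mor F L Z Y)) (Lad F))
        (comp_functor (Acat F) (Lad L) (MH (comp_adj_mor F L Z Y))) (upL (comp_adj_mor F L Z Y))"
    proof (intro nat_isomorphismI nat_transformationI)
      fix f assume f: "f \<in> Arr (Acat F)"
      have Z: "FAr (Lad L) (FAr (MH Z) (FAr (MH Y) f)) \<cdot>\<^bsub>Bcat L\<^esub> upL Z (FOb (MH Y) (Dom (Acat F) f))
          = upL Z (FOb (MH Y) (Cod (Acat F) f)) \<cdot>\<^bsub>Bcat L\<^esub> FAr (MK Z) (FAr (Lad G) (FAr (MH Y) f))"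
        using f Z.upL_naturality[of "FAr (MH Y) f"] by simp
      have Y: "FAr (MK Z) (FAr (Lad G) (FAr (MH Y) f)) \<cdot>\<^bsub>Bcat L\<^esub> FAr (MK Z) (upL Y (Dom (Acat F) f))
          = FAr (MK Z) (upL Y (Cod (Acat F) f)) \<cdot>\<^bsub>Bcat L\<^esub> FAr (MK Z) (FAr (MK Y) (FAr (Lad F) f))"
        using f arg_cong[OF Y.upL_naturality[OF f], of "FAr (MK Z)"] by simp
      show "FAr (comp_functor (Acat F) (Lad L) (MH (comp_adj_mor F L Z Y))) f
            \<cdot>\<^bsub>Bcat L\<^esub> upL (comp_adj_mor F L Z Y) (Dom (Acat F) f)
          = upL (comp_adj_mor F L Z Y) (Cod (Acat F) f)
            \<cdot>\<^bsub>Bcat L\<^esub> FAr (comp_functor (Acat F) (MK (comp_adj_mor F L Z Y)) (Lad F)) f"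
        using f by (simp add: Y Z.G.L.tgt.Comp_extend[OF Z])
    qed (simp_all add: cat_functor_comp[OF MH Z.G.Lad_functor] cat_functor_comp[OF Y.F.Lad_functor MK])
    show "nat_isomorphism (Bcat F) (Acat L) (comp_functor (Bcat F) (MH (comp_adj_mor F L Z Y)) (Rad F))
        (comp_functor (Bcat F) (Rad L) (MK (comp_adj_mor F L Z Y))) (upR (comp_adj_mor F L Z Y))"
    proof (intro nat_isomorphismI nat_transformationI)
      fix g assume g: "g \<in> Arr (Bcat F)"
      have Z: "FAr (Rad L) (FAr (MK Z) (FAr (MK Y) g)) \<cdot>\<^bsub>Acat L\<^esub> upR Z (FOb (MK Y) (Dom (Bcat F) g))
          = upR Z (FOb (MK Y) (Cod (Bcat F) g)) \<cdot>\<^bsub>Acat L\<^esub> FAr (MH Z) (FAr (Rad G) (FAr (MK Y) g))"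
        using g Z.upR_naturality[of "FAr (MK Y) g"] by simp
      have Y: "FAr (MH Z) (FAr (Rad G) (FAr (MK Y) g)) \<cdot>\<^bsub>Acat L\<^esub> FAr (MH Z) (upR Y (Dom (Bcat F) g))
          = FAr (MH Z) (upR Y (Cod (Bcat F) g)) \<cdot>\<^bsub>Acat L\<^esub> FAr (MH Z) (FAr (MH Y) (FAr (Rad F) g))"
        using g arg_cong[OF Y.upR_naturality[OF g], of "FAr (MH Z)"] by simp
      show "FAr (comp_functor (Bcat F) (Rad L) (MK (comp_adj_mor F L Z Y))) g
            \<cdot>\<^bsub>Acat L\<^esub> upR (comp_adj_mor F L Z Y) (Dom (Bcat F) g)
          = upR (comp_adj_mor F L Z Y) (Cod (Bcat F) g)
            \<cdot>\<^bsub>Acat L\<^esub> FAr (comp_functor (Bcat F) (MH (comp_adj_mor F L Z Y)) (Rad F)) g"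
        using g by (simp add: Y Z.G.L.src.Comp_extend[OF Z])
    qed (simp_all add: cat_functor_comp[OF MK Z.G.Rad_functor] cat_functor_comp[OF Y.F.Rad_functor MH])
  next
    fix a assume a: "a \<in> Obj (Acat F)"
    \<comment> \<open>Interchange: this swaps the inner cells of \<open>Z\<close> and
      \<open>Y\<close>. The cells of \<open>Y\<close> then form its unit condition under
      \<open>MH Z\<close>, and the unit condition of \<open>Z\<close> at \<open>FOb (MH Y) a\<close>
      remains.\<close>
    have nat: "FAr (Rad L) (FAr (MK Z) (upL Y a)) \<cdot>\<^bsub>Acat L\<^esub> upR Z (FOb (MK Y) (FOb (Lad F) a))
        = upR Z (FOb (Lad G) (FOb (MH Y) a)) \<cdot>\<^bsub>Acat L\<^esub> FAr (MH Z) (FAr (Rad G) (upL Y a))"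
      using a Z.upR_naturality[of "upL Y a"] by simp
    have "FAr (MH Z) (FAr (Rad G) (upL Y a)) \<cdot>\<^bsub>Acat L\<^esub> FAr (MH Z) (upR Y (FOb (Lad F) a))
          \<cdot>\<^bsub>Acat L\<^esub> FAr (MH Z) (FAr (MH Y) (Unit F a))
        = FAr (MH Z) (Unit G (FOb (MH Y) a))"
      using a arg_cong[OF Y.Unit_compat[OF a], of "FAr (MH Z)"] by simp
    then show "FAr (Rad L) (upL (comp_adj_mor F L Z Y) a)
          \<cdot>\<^bsub>Acat L\<^esub> upR (comp_adj_mor F L Z Y) (FOb (Lad F) a)
          \<cdot>\<^bsub>Acat L\<^esub> FAr (MH (comp_adj_mor F L Z Y)) (Unit F a)
        = Unit L (FOb (MH (comp_adj_mor F L Z Y)) a)"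
      using a Z.Unit_compat[of "FOb (MH Y) a"] by (simp add: Z.G.L.src.Comp_extend[OF nat])
  next
    fix b assume b: "b \<in> Obj (Bcat F)"
    have nat: "FAr (Lad L) (FAr (MH Z) (upR Y b)) \<cdot>\<^bsub>Bcat L\<^esub> upL Z (FOb (MH Y) (FOb (Rad F) b))
        = upL Z (FOb (Rad G) (FOb (MK Y) b)) \<cdot>\<^bsub>Bcat L\<^esub> FAr (MK Z) (FAr (Lad G) (upR Y b))"
      using b Z.upL_naturality[of "upR Y b"] by simp
    \<comment> \<open>The counit condition of \<open>Z\<close> with a tail \<open>h\<close>, since
      after the interchange the cells of \<open>Y\<close> stand to the right of its three
      factors.\<close>
    have Z: "Counit L (FOb (MK Z) (FOb (MK Y) b)) \<cdot>\<^bsub>Bcat L\<^esub> FAr (Lad L) (upR Z (FOb (MK Y) b))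
          \<cdot>\<^bsub>Bcat L\<^esub> upL Z (FOb (Rad G) (FOb (MK Y) b)) \<cdot>\<^bsub>Bcat L\<^esub> h
        = FAr (MK Z) (Counit G (FOb (MK Y) b)) \<cdot>\<^bsub>Bcat L\<^esub> h"
      if "h \<in> Arr (Bcat L)" "Cod (Bcat L) h = FOb (MK Z) (FOb (Lad G) (FOb (Rad G) (FOb (MK Y) b)))" for h
      using b that by (simp flip: Z.Counit_compat)
    have "FAr (MK Z) (Counit G (FOb (MK Y) b)) \<cdot>\<^bsub>Bcat L\<^esub> FAr (MK Z) (FAr (Lad G) (upR Y b))
          \<cdot>\<^bsub>Bcat L\<^esub> FAr (MK Z) (upL Y (FOb (Rad F) b))
        = FAr (MK Z) (FAr (MK Y) (Counit F b))"
      using b arg_cong[OF Y.Counit_compat[OF b], of "FAr (MK Z)"] by simp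
    then show "Counit L (FOb (MK (comp_adj_mor F L Z Y)) b)
          \<cdot>\<^bsub>Bcat L\<^esub> FAr (Lad L) (upR (comp_adj_mor F L Z Y) b)
          \<cdot>\<^bsub>Bcat L\<^esub> upL (comp_adj_mor F L Z Y) (FOb (Rad F) b)
        = FAr (MK (comp_adj_mor F L Z Y)) (Counit F b)"
      using b by (simp add: Z.G.L.tgt.Comp_extend[OF nat] Z)
  qed (simp_all add: MH MK)
qed

lemma comp_adj_mor_id:
  assumes "adj_morphism F G Y"
  shows "comp_adj_mor F G Y (id_adj_mor F) = Y" "comp_adj_mor F G (id_adj_mor G) Y = Y"
proof -
  interpret Y: adj_morphism F G Y by fact
  note id = adj_morphism_id[OF Y.F.adjunction_axioms] adj_morphism_id[OF Y.G.adjunction_axioms]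
  show "comp_adj_mor F G Y (id_adj_mor F) = Y"
    by (rule adj_mor_eqI[OF adj_morphism_comp[OF id(1) assms] assms])
      (simp_all add: comp_functor_id[OF Y.MH_functor] comp_functor_id[OF Y.MK_functor])
  show "comp_adj_mor F G (id_adj_mor G) Y = Y"
    by (rule adj_mor_eqI[OF adj_morphism_comp[OF assms id(2)] assms])
      (simp_all add: comp_functor_id[OF Y.MH_functor] comp_functor_id[OF Y.MK_functor])
qed

lemma comp_adj_mor_assoc:
  assumes Y: "adj_morphism F G Y" and Z: "adj_morphism G L Z" and W: "adj_morphism L M W"
  shows "comp_adj_mor F M (comp_adj_mor G M W Z) Y = comp_adj_mor F M W (comp_adj_mor F L Z Y)"
proof -
  interpret Y: adj_morphism F G Y by fact
  interpret Z: adj_morphism G L Z by fact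
  interpret W: adj_morphism L M W by fact
  show ?thesis
    by (rule adj_mor_eqI[OF adj_morphism_comp[OF Y adj_morphism_comp[OF Z W]]
          adj_morphism_comp[OF adj_morphism_comp[OF Y Z] W]])
      (simp_all add: comp_functor_assoc[OF Y.MH_functor] comp_functor_assoc[OF Y.MK_functor])
qed

lemma Adj_simps [simp]:
  "F \<in> Obj Adj \<longleftrightarrow> adjunction F"
  "(F, Y, G) \<in> Arr Adj \<longleftrightarrow> adj_morphism F G Y"
  "Dom Adj (F, Y, G) = F"
  "Cod Adj (F, Y, G) = G"
  "Ide Adj F = (F, id_adj_mor F, F)"
  "(G', Z, L) \<cdot>\<^bsub>Adj\<^esub> (F, Y, G) = (F, comp_adj_mor F L Z Y, L)"
  by (simp_all add: Adj_def)

lemma adj_morphism_adjunction: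
  assumes "adj_morphism F G Y"
  shows "adjunction F" "adjunction G"
  using assms by (auto simp: adj_morphism_def)

lemma category_Adj: "category Adj"
proof
  fix h g f :: "('a, 'b, 'c, 'd) adj \<times> ('a, 'b, 'c, 'd, 'a, 'b, 'c, 'd) adj_mor \<times> ('a, 'b, 'c, 'd) adj"
    and w x y z
  assume "f \<in> Hom Adj w x" "g \<in> Hom Adj x y" "h \<in> Hom Adj y z"
  then show "(h \<cdot>\<^bsub>Adj\<^esub> g) \<cdot>\<^bsub>Adj\<^esub> f = h \<cdot>\<^bsub>Adj\<^esub> (g \<cdot>\<^bsub>Adj\<^esub> f)"
    by (cases f; cases g; cases h) (simp add: mem_Hom comp_adj_mor_assoc)
qed (auto simp: mem_Hom adj_morphism_adjunction adj_morphism_id adj_morphism_comp comp_adj_mor_id)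

section \<open>Functoriality of the nucleus\<close>

lemma Nuc_mor_id:
  assumes "adjunction F"
  shows "Nuc_mor F F (id_adj_mor F) = id_adj_mor (Nuc F)"
proof -
  interpret F: adjunction F by fact
  interpret I: adj_morphism F F "id_adj_mor F"
    by (rule adj_morphism_id) fact
  \<comment> \<open>The monad and comonad isomorphisms of the identity morphism are identities, so
    transport leaves every structure arrow unchanged.\<close>
  have K: "K_ups_ob F F (id_adj_mor F) s = s" if "s \<in> Obj (Coalg F)" for s
    using that by (cases s) (simp add: I.K_ups_ob_eq I.comonad_iso_def F.Obj_Coalg)
  have H: "H_ups_ob F F (id_adj_mor F) s = s" if "s \<in> Obj (Alg F)" for s
    using that by (cases s) (simp add: I.H_ups_ob_eq I.monad_iso_def F.Obj_Alg)
  show ?thesis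
  proof (rule adj_mor_eqI[OF I.adj_morphism_Nuc adj_morphism_id[OF F.adjunction_Nuc]])
    have "K_ups F F (id_adj_mor F) = id_functor (Coalg F)"
    proof (rule functr_eqI[OF I.K_ups_functor cat_functor_id[OF F.Coalg.category_axioms]])
      fix a assume "a \<in> Arr (Coalg F)"
      then show "FAr (K_ups F F (id_adj_mor F)) a = FAr (id_functor (Coalg F)) a"
        by (cases a) (simp, simp add: F.Arr_Coalg K)
    qed (simp add: K)
    then show "MH (Nuc_mor F F (id_adj_mor F)) = MH (id_adj_mor (Nuc F))" by simp
    have "H_ups F F (id_adj_mor F) = id_functor (Alg F)"
    proof (rule functr_eqI[OF I.H_ups_functor cat_functor_id[OF F.Alg.category_axioms]])
      fix a assume "a \<in> Arr (Alg F)"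
      then show "FAr (H_ups F F (id_adj_mor F)) a = FAr (id_functor (Alg F)) a"
        by (cases a) (simp, simp add: F.Arr_Alg H)
    qed (simp add: H)
    then show "MK (Nuc_mor F F (id_adj_mor F)) = MK (id_adj_mor (Nuc F))" by simp
  qed (simp_all add: H K F.kappa0_ob_Coalg F.kappa1_ob_Alg)
qed

text \<open>By interchange of cells, the monad and comonad isomorphisms of the pasting are those of
  \<open>Z\<close> after the images of those of \<open>Y\<close>. Transporting a structure arrow in
  one step or in two therefore gives the same object, and the underlying arrows of the cells paste
  as before.\<close>

lemma Nuc_mor_comp:
  assumes Y: "adj_morphism F G Y" and Z: "adj_morphism G L Z"
  shows "Nuc_mor F L (comp_adj_mor F L Z Y)
    = comp_adj_mor (Nuc F) (Nuc L) (Nuc_mor G L Z) (Nuc_mor F G Y)"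
proof -
  interpret Y: adj_morphism F G Y by fact
  interpret Z: adj_morphism G L Z by fact
  interpret ZY: adj_morphism F L "comp_adj_mor F L Z Y"
    by (rule adj_morphism_comp) fact+
  have K: "K_ups_ob F L (comp_adj_mor F L Z Y) s = K_ups_ob G L Z (K_ups_ob F G Y s)"
    if s: "s \<in> Obj (Coalg F)" for s
  proof -
    have "FAr (Lad L) (FAr (MH Z) (upR Y (fst s))) \<cdot>\<^bsub>Bcat L\<^esub> upL Z (FOb (MH Y) (FOb (Rad F) (fst s)))
        = upL Z (FOb (Rad G) (FOb (MK Y) (fst s))) \<cdot>\<^bsub>Bcat L\<^esub> FAr (MK Z) (FAr (Lad G) (upR Y (fst s)))"
      using s Z.upL_naturality[of "upR Y (fst s)"] by simp
    from Z.G.L.tgt.Comp_extend[OF this] show ?thesis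
      using s Y.K_ups_ob_Coalg[OF s]
      by (simp add: ZY.K_ups_ob_eq Z.K_ups_ob_eq)
        (simp add: Y.K_ups_ob_eq ZY.comonad_iso_def Z.comonad_iso_def Y.comonad_iso_def)
  qed
  have H: "H_ups_ob F L (comp_adj_mor F L Z Y) s = H_ups_ob G L Z (H_ups_ob F G Y s)"
    if s: "s \<in> Obj (Alg F)" for s
  proof -
    have nat: "FAr (Rad L) (FAr (MK Z) (upL Y (fst s))) \<cdot>\<^bsub>Acat L\<^esub> upR Z (FOb (MK Y) (FOb (Lad F) (fst s)))
        = upR Z (FOb (Lad G) (FOb (MH Y) (fst s))) \<cdot>\<^bsub>Acat L\<^esub> FAr (MH Z) (FAr (Rad G) (upL Y (fst s)))"
      using s Z.upR_naturality[of "upL Y (fst s)"] by simp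
    \<comment> \<open>The factorization is proved before inverting, because \<open>H_ups_ob\<close>
      uses the inverse; \<open>MH Z\<close> preserves inverses.\<close>
    have "ZY.monad_iso (fst s) = Z.monad_iso (FOb (MH Y) (fst s)) \<cdot>\<^bsub>Acat L\<^esub> FAr (MH Z) (Y.monad_iso (fst s))"
      using s by (simp add: ZY.monad_iso_def Z.monad_iso_def Y.monad_iso_def Z.G.L.src.Comp_extend[OF nat])
    then show ?thesis
      using s Y.H_ups_ob_Alg[OF s]
      by (simp add: ZY.H_ups_ob_eq Z.H_ups_ob_eq) (simp add: Y.H_ups_ob_eq)
  qed
  show ?thesis
  proof (rule adj_mor_eqI[OF ZY.adj_morphism_Nuc adj_morphism_comp[OF Y.adj_morphism_Nuc Z.adj_morphism_Nuc]])
    interpret K: cat_functor "Coalg F" "Coalg G" "K_ups F G Y" by (rule Y.K_ups_functor)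
    interpret H: cat_functor "Alg F" "Alg G" "H_ups F G Y" by (rule Y.H_ups_functor)
    have "K_ups F L (comp_adj_mor F L Z Y) = comp_functor (Coalg F) (K_ups G L Z) (K_ups F G Y)"
    proof (rule functr_eqI[OF ZY.K_ups_functor cat_functor_comp[OF Y.K_ups_functor Z.K_ups_functor]])
      fix a assume a: "a \<in> Arr (Coalg F)"
      then show "FAr (K_ups F L (comp_adj_mor F L Z Y)) a
          = FAr (comp_functor (Coalg F) (K_ups G L Z) (K_ups F G Y)) a"
        using K.FAr_arrow(1)[OF a] by (cases a) (simp, simp add: Y.F.Arr_Coalg K)
    qed (simp add: K Y.K_ups_ob_Coalg)
    then show "MH (Nuc_mor F L (comp_adj_mor F L Z Y))
        = MH (comp_adj_mor (Nuc F) (Nuc L) (Nuc_mor G L Z) (Nuc_mor F G Y))"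
      by simp
    have "H_ups F L (comp_adj_mor F L Z Y) = comp_functor (Alg F) (H_ups G L Z) (H_ups F G Y)"
    proof (rule functr_eqI[OF ZY.H_ups_functor cat_functor_comp[OF Y.H_ups_functor Z.H_ups_functor]])
      fix a assume a: "a \<in> Arr (Alg F)"
      then show "FAr (H_ups F L (comp_adj_mor F L Z Y)) a
          = FAr (comp_functor (Alg F) (H_ups G L Z) (H_ups F G Y)) a"
        using H.FAr_arrow(1)[OF a] by (cases a) (simp, simp add: Y.F.Arr_Alg H)
    qed (simp add: H Y.H_ups_ob_Alg)
    then show "MK (Nuc_mor F L (comp_adj_mor F L Z Y))
        = MK (comp_adj_mor (Nuc F) (Nuc L) (Nuc_mor G L Z) (Nuc_mor F G Y))"
      by simp
  qed (simp_all add: H K Y.F.kappa0_ob_Coalg Y.F.kappa1_ob_Alg Y.K_ups_ob_Coalg Y.H_ups_ob_Alg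
      Y.upL_Coalg_arrow Y.upR_Alg_arrow)
qed

lemma Nuc_functor_apply [simp]:
  "adjunction F \<Longrightarrow> FOb Nuc_functor F = Nuc F"
  "adj_morphism F G Y \<Longrightarrow> FAr Nuc_functor (F, Y, G) = (Nuc F, Nuc_mor F G Y, Nuc G)"
  by (simp_all add: Nuc_functor_def)

lemma Nuc_functor_functor: "cat_functor Adj Adj Nuc_functor"
  by (rule cat_functorI)
    (auto simp: category_Adj adjunction.adjunction_Nuc adj_morphism.adj_morphism_Nuc
      adj_morphism_adjunction adj_morphism_id adj_morphism_comp Nuc_mor_id Nuc_mor_comp,
      auto simp: Nuc_functor_def extensional_def)

theorem proposition4p3:
  shows "(\<forall>F :: ('oa, 'ma, 'ob, 'mb) adj. adjunction F \<longrightarrow>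
        adjunction (Nuc F) \<and>
        (\<forall>\<beta>\<in>Obj (Coalg F). \<forall>\<alpha>\<in>Obj (Alg F).
          bij_betw (nuc_transpose F \<beta> \<alpha>)
            (Hom (Alg F) (FOb (upper_sharp F) \<beta>) \<alpha>)
            (Hom (Coalg F) \<beta> (FOb (lower_sharp F) \<alpha>))))
    \<and> (\<forall>(F :: ('oa, 'ma, 'ob, 'mb) adj) (G :: ('oc, 'mc, 'od, 'md) adj) Y.
        adj_morphism F G Y \<longrightarrow> adj_morphism (Nuc F) (Nuc G) (Nuc_mor F G Y))
    \<and> cat_functor (Adj :: (('oa, 'ma, 'ob, 'mb) adj, _) cat) Adj Nuc_functor"
  by (simp add: adjunction.adjunction_Nuc adjunction.bij_betw_nuc_transpose
      adj_morphism.adj_morphism_Nuc Nuc_functor_functor)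

end
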